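(* Let $0<\alpha<1$. Let $\{M_0(t)\}_{t\ge0}$ and $\{M(t)\}_{t\ge0}$ be independent generalized counting processes with positive rates $\mu_1,\dots,\mu_{k_0}$ and $\lambda_1,\dots,\lambda_k$, respectively, and let $\hat M^\alpha(t)=M(M_0(Y^\alpha(t)))$, where $\{Y^\alpha(t)\}_{t\ge0}$ is an inverse $\alpha$-stable subordinator independent of $(M,M_0)$. Then the one-dimensional distributions of $\{\hat M^\alpha(t)\}_{t\ge0}$ (that is, the distributions of $\hat M^\alpha(t)$, $t>0$) are not infinitely divisible.
   Context: A generalized counting process (GCP) $\{M(t)\}_{t\ge0}$ with positive rates $\lambda_1,\dots,\lambda_k$ is a right-continuous $\mathbb{N}_0$-valued process with $M(0)=0$ and stationary independent increments, whose probability generating function is $\mathbb{E}(u^{M(t)})=\exp\big(-t\sum_{j=1}^{k}\lambda_j(1-u^j)\big)$, $|u|\le1$. An $\alpha$-stable subordinator $D^\alpha$ is a non-decreasing Lévy process with $\mathbb{E}(e^{-sD^\alpha(t)})=e^{-ts^\alpha}$, $s>0$; the inverse $\alpha$-stable subordinator is $Y^\alpha(t)=\inf\{x>0:D^\alpha(x)>t\}$. The process $\hat M^\alpha$ is called the time-changed IGCP. *)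

theory Defs
  imports "HOL-Probability.Probability"
begin

text \<open>
  A stochastic process is a curried function of time and outcome. Time is of type real, but
  only the times in \<open>{0..}\<close> matter; nothing is assumed about negative times.
\<close>

definition stationary_increments :: "'a measure \<Rightarrow> (real \<Rightarrow> 'a \<Rightarrow> real) \<Rightarrow> bool" where
  "stationary_increments P X \<longleftrightarrow>
     (\<forall>s\<ge>0. \<forall>t\<ge>0. distr P borel (\<lambda>\<omega>. X (s + t) \<omega> - X s \<omega>)
                  = distr P borel (\<lambda>\<omega>. X t \<omega> - X 0 \<omega>))"

definition independent_increments :: "'a measure \<Rightarrow> (real \<Rightarrow> 'a \<Rightarrow> real) \<Rightarrow> bool" where
  "independent_increments P X \<longleftrightarrow>
     (\<forall>(n::nat) (\<tau>::nat \<Rightarrow> real). 0 \<le> \<tau> 0 \<and> mono_on {..n} \<tau> \<longrightarrow>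
        prob_space.indep_vars P (\<lambda>_. borel) (\<lambda>i \<omega>. X (\<tau> (Suc i)) \<omega> - X (\<tau> i) \<omega>) {..<n})"

definition right_continuous_paths :: "'a measure \<Rightarrow> (real \<Rightarrow> 'a \<Rightarrow> real) \<Rightarrow> bool" where
  "right_continuous_paths P X \<longleftrightarrow>
     (\<forall>\<omega>\<in>space P. \<forall>t\<ge>0. continuous (at_right t) (\<lambda>s. X s \<omega>))"

definition left_limit_paths :: "'a measure \<Rightarrow> (real \<Rightarrow> 'a \<Rightarrow> real) \<Rightarrow> bool" where
  "left_limit_paths P X \<longleftrightarrow>
     (\<forall>\<omega>\<in>space P. \<forall>t>0. \<exists>l. ((\<lambda>s. X s \<omega>) \<longlongrightarrow> l) (at_left t))"

definition levy_process :: "'a measure \<Rightarrow> (real \<Rightarrow> 'a \<Rightarrow> real) \<Rightarrow> bool" where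
  "levy_process P X \<longleftrightarrow>
     (\<forall>t\<ge>0. X t \<in> borel_measurable P) \<and>
     (AE \<omega> in P. X 0 \<omega> = 0) \<and>
     stationary_increments P X \<and> independent_increments P X \<and>
     right_continuous_paths P X \<and> left_limit_paths P X"

text \<open>
  Increments of a counting process are taken after embedding into the reals, because
  subtraction on nat truncates. The rates are \<open>rate 1, \<dots>, rate k\<close>.
\<close>

definition generalized_counting_process ::
    "'a measure \<Rightarrow> nat \<Rightarrow> (nat \<Rightarrow> real) \<Rightarrow> (real \<Rightarrow> 'a \<Rightarrow> nat) \<Rightarrow> bool" where
  "generalized_counting_process P k rate M \<longleftrightarrow>
     1 \<le> k \<and> (\<forall>j\<in>{1..k}. 0 < rate j) \<and>
     (\<forall>t\<ge>0. M t \<in> measurable P (count_space UNIV)) \<and>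
     (AE \<omega> in P. M 0 \<omega> = 0) \<and>
     right_continuous_paths P (\<lambda>t \<omega>. real (M t \<omega>)) \<and>
     stationary_increments P (\<lambda>t \<omega>. real (M t \<omega>)) \<and>
     independent_increments P (\<lambda>t \<omega>. real (M t \<omega>)) \<and>
     (\<forall>t\<ge>0. \<forall>u::real. \<bar>u\<bar> \<le> 1 \<longrightarrow>
        prob_space.expectation P (\<lambda>\<omega>. u ^ M t \<omega>)
          = exp (- t * (\<Sum>j = 1..k. rate j * (1 - u ^ j))))"

definition stable_subordinator :: "'a measure \<Rightarrow> real \<Rightarrow> (real \<Rightarrow> 'a \<Rightarrow> real) \<Rightarrow> bool" where
  "stable_subordinator P \<alpha> D \<longleftrightarrow>
     levy_process P D \<and>
     (\<forall>\<omega>\<in>space P. mono_on {0..} (\<lambda>t. D t \<omega>)) \<and>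
     (\<forall>t\<ge>0. \<forall>s>0. prob_space.expectation P (\<lambda>\<omega>. exp (- s * D t \<omega>)) = exp (- t * s powr \<alpha>))"

text \<open>
  The infimum is taken in \<open>[0, \<infinity>]\<close>, so that it is \<open>\<infinity>\<close> for the empty set. For a stable
  subordinator this happens only on a null event, on which enn2real yields the value 0.
\<close>

definition first_passage :: "(real \<Rightarrow> 'a \<Rightarrow> real) \<Rightarrow> real \<Rightarrow> 'a \<Rightarrow> real" where
  "first_passage D t \<omega> = enn2real (INF x\<in>{x. 0 < x \<and> D x \<omega> > t}. ennreal x)"

definition inverse_stable_subordinator ::
    "'a measure \<Rightarrow> real \<Rightarrow> (real \<Rightarrow> 'a \<Rightarrow> real) \<Rightarrow> bool" where
  "inverse_stable_subordinator P \<alpha> Y \<longleftrightarrow>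
     (\<exists>D. stable_subordinator P \<alpha> D \<and> (\<forall>t\<ge>0. \<forall>\<omega>\<in>space P. Y t \<omega> = first_passage D t \<omega>))"

text \<open>
  The library's \<open>indep_var\<close> requires both random variables to have the same value type;
  the following is the same notion without this restriction.
\<close>

definition indep_elements ::
    "'a measure \<Rightarrow> 'b measure \<Rightarrow> ('a \<Rightarrow> 'b) \<Rightarrow> 'c measure \<Rightarrow> ('a \<Rightarrow> 'c) \<Rightarrow> bool" where
  "indep_elements P S X T Z \<longleftrightarrow>
     X \<in> measurable P S \<and> Z \<in> measurable P T \<and>
     prob_space.indep_set P {X -` A \<inter> space P | A. A \<in> sets S} {Z -` B \<inter> space P | B. B \<in> sets T}"

text \<open>
  Independence of processes means independence of their paths, viewed as random elements of
  the product space over the time set \<open>{0..}\<close>.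
\<close>

definition process_path :: "(real \<Rightarrow> 'a \<Rightarrow> 'b) \<Rightarrow> 'a \<Rightarrow> real \<Rightarrow> 'b" where
  "process_path X \<omega> = (\<lambda>t\<in>{0..}. X t \<omega>)"

definition nat_path_space :: "(real \<Rightarrow> nat) measure" where
  "nat_path_space = PiM {0..} (\<lambda>_. count_space UNIV)"

definition real_path_space :: "(real \<Rightarrow> real) measure" where
  "real_path_space = PiM {0..} (\<lambda>_. borel)"

definition time_changed_IGCP ::
    "(real \<Rightarrow> 'a \<Rightarrow> nat) \<Rightarrow> (real \<Rightarrow> 'a \<Rightarrow> nat) \<Rightarrow> (real \<Rightarrow> 'a \<Rightarrow> real) \<Rightarrow> real \<Rightarrow> 'a \<Rightarrow> nat" where
  "time_changed_IGCP M M0 Y t \<omega> = M (real (M0 (Y t \<omega>) \<omega>)) \<omega>"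

definition infinitely_divisible :: "real measure \<Rightarrow> bool" where
  "infinitely_divisible \<mu> \<longleftrightarrow>
     real_distribution \<mu> \<and>
     (\<forall>n\<ge>1. \<exists>\<nu>. real_distribution \<nu> \<and> \<mu> = (convolution \<nu> ^^ n) (return borel 0))"

end

theory Submission
  imports Defs "HOL-Complex_Analysis.Complex_Analysis"
    "HOL-Computational_Algebra.Fundamental_Theorem_Algebra"
begin

text \<open>
  An infinitely divisible law with all exponential moments has an entire Laplace transform that is
  an \<open>n\<close>-th power of an entire function for every \<open>n\<close>, hence has no zeros. The law of
  \<open>M(M\<^sub>0(Y(t)))\<close> violates this: its transform is \<open>z \<mapsto> F(- \<psi>\<^sub>0(exp(- \<psi>(exp z))))\<close>, where
  \<open>F(z) = E exp(z Y(t))\<close>, \<open>\<psi>(u) = \<Sum>\<^sub>j \<lambda>\<^sub>j (1 - u\<^sup>j)\<close> and \<open>\<psi>\<^sub>0(u) = \<Sum>\<^sub>j \<mu>\<^sub>j (1 - u\<^sup>j)\<close>. The function \<open>F\<close> is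
  entire of finite order because \<open>P(Y(t) > y) \<le> P(D(y) \<le> t) \<le> exp(s t - y s\<^sup>\<alpha>)\<close> for all
  \<open>s > 0\<close>; if it had no zeros it would be the exponential of a polynomial, which is impossible
  since \<open>F(- x)\<close> tends to 0 more slowly than any exponential. The zeros of \<open>F\<close> are not real, and a
  nonreal value of \<open>- \<psi>\<^sub>0(exp(- \<psi>(exp z)))\<close> is attained by the fundamental theorem of algebra,
  applied to \<open>\<psi>\<^sub>0\<close> and then to \<open>\<psi>\<close>.
\<close>

section \<open>Entire functions\<close>

text \<open>The order of a zero would be divisible by every \<open>n\<close>.\<close>

lemma zero_free_if_all_roots:
  fixes f :: "complex \<Rightarrow> complex"
  assumes roots: "\<And>n. 1 \<le> n \<Longrightarrow> \<exists>g. g holomorphic_on UNIV \<and> (\<forall>z. f z = g z ^ n)"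
    and nz: "f a \<noteq> 0"
  shows "f z \<noteq> 0"
proof
  assume fz: "f z = 0"
  have holf: "f holomorphic_on UNIV"
  proof -
    obtain g where "g holomorphic_on UNIV" "\<forall>z. f z = g z ^ 1"
      using roots[of 1] by auto
    moreover from this have "f = g" by auto
    ultimately show ?thesis by simp
  qed
  \<comment> \<open>\<open>zorder\<close> carries information only at an isolated zero. The identity
    theorem provides this, as \<open>h\<close> does not vanish at \<open>a\<close>.\<close>
  have freq: "frequently (\<lambda>w. h w \<noteq> 0) (at z)" if "h holomorphic_on UNIV" "h a \<noteq> 0" for h :: "complex \<Rightarrow> complex"
    using non_zero_neighbour_alt[of h UNIV z a] that
    by (simp add: eventually_frequently connected_UNIV)
  \<comment> \<open>One more than the order of the zero of \<open>f\<close>; yet that order is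
    \<open>m\<close> times the positive order of a zero of \<open>g\<close>, hence at least
    \<open>m\<close>.\<close>
  define m where "m = nat (zorder f z) + 1"
  obtain g where g: "g holomorphic_on UNIV" "\<And>z. f z = g z ^ m"
    using roots[of m] by (auto simp: m_def)
  have gz: "g z = 0" "g a \<noteq> 0"
    using g(2)[of z] g(2)[of a] fz nz by (auto simp: m_def)
  have mero: "g meromorphic_on {z}"
    using g(1) by (meson analytic_on_imp_meromorphic_on analytic_on_holomorphic open_UNIV subset_UNIV)
  have "f = (\<lambda>w. g w ^ m)" using g(2) by auto
  then have "zorder f z = int m * zorder g z"
    using zorder_power[OF mero freq[OF g(1) gz(2)], of m] by simp
  moreover have "zorder g z > 0"
    using zorder_pos_iff'[of g z] g(1) gz freq[OF g(1) gz(2)]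
    by (metis analytic_on_holomorphic open_UNIV subset_UNIV)
  ultimately have "zorder f z \<ge> int m"
    by (metis less_eq_iff_succ_less mult.right_neutral mult_left_mono of_nat_0_le_iff zless_add1_eq add_0 int_one_le_iff_zero_less)
  then show False unfolding m_def by linarith
qed

text \<open>The Schwarz lemma applied to \<open>H / (2A - H)\<close>, rescaled to the unit disc.\<close>

lemma Borel_Caratheodory_half:
  assumes hol: "H holomorphic_on ball 0 r" and "0 < r" "0 < A" and "H 0 = 0"
    and Re_less: "\<And>z. norm z < r \<Longrightarrow> Re (H z) < A"
    and z: "norm z \<le> r / 2"
  shows "norm (H z) \<le> 2 * A"
proof -
  define g where "g = (\<lambda>w :: complex. H (r * w) / (2 * A - H (r * w)))"
  have in_ball: "norm (r * w) < r" if "norm w < 1" for w :: complex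
    using that \<open>0 < r\<close> by (simp add: norm_mult)
  have Re_w: "Re (H (r * w)) < A" if "norm w < 1" for w :: complex
    by (rule Re_less[OF in_ball[OF that]])
  have nz: "2 * A - H (r * w) \<noteq> 0" if "norm w < 1" for w :: complex
    using Re_w[OF that] \<open>0 < A\<close> by (auto simp: complex_eq_iff)
  \<comment> \<open>The half-plane Re v < A consists of points nearer to 0 than to 2A, so v / (2A -
    v) maps it into the unit disc.\<close>
  have less: "norm v < norm (2 * A - v)" if "Re v < A" for v :: complex
  proof -
    have "A * Re v < A * A" using that \<open>0 < A\<close> by simp
    then have "norm v ^ 2 < norm (2 * A - v) ^ 2"
      unfolding cmod_power2 by (simp add: power2_eq_square algebra_simps)
    then show ?thesis by (rule power_less_imp_less_base) simp
  qed
  have hol_r: "(\<lambda>w :: complex. H (r * w)) holomorphic_on ball 0 1"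
    by (rule holomorphic_on_compose_gen[of _ _ H "ball 0 r", unfolded o_def])
      (use hol in_ball in \<open>auto intro!: holomorphic_intros\<close>)
  have "norm (g w) \<le> norm w" if "norm w < 1" for w :: complex
  proof (rule Schwarz_Lemma(1))
    show "g holomorphic_on ball 0 1"
      unfolding g_def using nz by (auto intro!: holomorphic_intros hol_r)
    show "g 0 = 0" by (simp add: g_def \<open>H 0 = 0\<close>)
    show "norm (g z) < 1" if "norm z < 1" for z
      unfolding g_def using less[OF Re_w[OF that]] nz[OF that] by (simp add: norm_divide)
  qed (use that in auto)
  from this[of "z / r"] have "norm (g (z / r)) \<le> norm z / r"
    using z \<open>0 < r\<close> by (simp add: norm_divide)
  also have "\<dots> \<le> 1 / 2"
    using z \<open>0 < r\<close> by (simp add: field_simps)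
  finally have "norm (H z) / norm (2 * A - H z) \<le> 1 / 2"
    using \<open>0 < r\<close> by (simp add: g_def norm_divide)
  moreover have "2 * A - H z \<noteq> 0"
    using nz[of "z / r"] z \<open>0 < r\<close> by (simp add: norm_divide)
  ultimately have "norm (H z) \<le> norm (2 * A - H z) / 2"
    by (simp add: field_simps)
  also have "\<dots> \<le> (2 * A + norm (H z)) / 2"
    using norm_triangle_ineq4[of "of_real (2 * A)" "H z"] \<open>0 < A\<close> by (simp add: norm_mult)
  finally show ?thesis by simp
qed

text \<open>Hadamard's factorization in the zero-free case. The real part of a holomorphic logarithm
  grows at most polynomially; the Borel-Caratheodory estimate on a disc of twice the radius carries
  this over to its modulus, and Liouville's theorem makes it a polynomial.\<close>

lemma zero_free_finite_order_imp_exp_poly: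
  assumes hol: "f holomorphic_on UNIV" and nz: "\<And>z. f z \<noteq> 0"
    and "0 < C" and bound: "\<And>z. norm (f z) \<le> exp (C * (1 + norm z) ^ m)"
  shows "\<exists>p. \<forall>z. f z = exp (poly p z)"
proof -
  obtain H where H: "H holomorphic_on UNIV" "\<And>z. f z = exp (H z)"
    using holomorphic_logarithm_exists[of UNIV f 0] hol nz by (metis UNIV_I convex_UNIV open_UNIV)
  \<comment> \<open>The summand 1 makes the bound on Re (H w - H 0) strict, as the half-plane
    estimate requires.\<close>
  define K where "K = norm (H 0) + 1"
  have "0 < K" by (simp add: K_def add_nonneg_pos)
  have Re_H: "Re (H z) \<le> C * (1 + norm z) ^ m" for z
    using bound[of z] by (simp add: H(2))
  \<comment> \<open>For norm z at least 1, constants are absorbed by powers of norm z. Liouville's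
    theorem only needs the growth bound there.\<close>
  have "norm (H z - H 0) \<le> 2 * (C * 3 ^ m + K) * norm z ^ m" if "1 \<le> norm z" for z
  proof -
    have "norm (H z - H 0) \<le> 2 * (C * (1 + 2 * norm z) ^ m + K)"
    proof (rule Borel_Caratheodory_half[of "\<lambda>w. H w - H 0" "2 * norm z"])
      show "(\<lambda>w. H w - H 0) holomorphic_on ball 0 (2 * norm z)"
        using H(1) by (intro holomorphic_intros) (auto intro: holomorphic_on_subset)
      show "0 < C * (1 + 2 * norm z) ^ m + K"
        using \<open>0 < C\<close> \<open>0 < K\<close> by (intro add_nonneg_pos) auto
      fix w :: complex assume "norm w < 2 * norm z"
      then have "C * (1 + norm w) ^ m \<le> C * (1 + 2 * norm z) ^ m"
        using \<open>0 < C\<close> by (intro mult_left_mono power_mono) auto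
      moreover have "- Re (H 0) < K"
        using abs_Re_le_cmod[of "H 0"] by (simp add: K_def)
      ultimately show "Re (H w - H 0) < C * (1 + 2 * norm z) ^ m + K"
        using Re_H[of w] by simp
    qed (use that in auto)
    also have "\<dots> \<le> 2 * (C * (3 * norm z) ^ m + K * norm z ^ m)"
    proof -
      have "C * (1 + 2 * norm z) ^ m \<le> C * (3 * norm z) ^ m"
        using \<open>0 < C\<close> that by (intro mult_left_mono power_mono) auto
      moreover have "K * 1 \<le> K * norm z ^ m"
        using \<open>0 < K\<close> that by (intro mult_left_mono one_le_power) auto
      ultimately show ?thesis by simp
    qed
    finally show ?thesis by (simp add: algebra_simps)
  qed
  then have *: "H z - H 0 = (\<Sum>k\<le>m. (deriv ^^ k) (\<lambda>z. H z - H 0) 0 / fact k * z ^ k)" for z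
    using Liouville_polynomial[of "\<lambda>z. H z - H 0" 1 "2 * (C * 3 ^ m + K)" m z] H(1)
    by (simp add: holomorphic_on_diff)
  define p where "p = [:H 0:] + (\<Sum>k\<le>m. monom ((deriv ^^ k) (\<lambda>z. H z - H 0) 0 / fact k) k)"
  have "H z = poly p z" for z
    using *[of z] by (simp add: p_def poly_sum poly_monom algebra_simps)
  then show ?thesis using H(2) by auto
qed

text \<open>The series and \<open>g\<close> agree on (0,1), hence on the unit disc by the identity
  theorem. So the series is the Taylor series at 0 of an entire function and converges
  everywhere.\<close>

lemma pgf_sums_entire:
  fixes a :: "nat \<Rightarrow> real" and g :: "complex \<Rightarrow> complex"
  assumes "\<And>n. 0 \<le> a n" "summable a" and hol: "g holomorphic_on UNIV"
    and eq: "\<And>x. 0 < x \<Longrightarrow> x < 1 \<Longrightarrow> (\<lambda>n. complex_of_real (a n * x ^ n)) sums g (of_real x)"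
  shows "(\<lambda>n. of_real (a n) * z ^ n) sums g z"
proof -
  have smb: "summable (\<lambda>n. complex_of_real (a n) * z ^ n)" if "norm z < 1" for z
  proof (rule summable_comparison_test'[OF \<open>summable a\<close>, of 0])
    show "norm (complex_of_real (a n) * z ^ n) \<le> a n" for n
      using assms(1)[of n] that
      by (simp add: norm_mult norm_power power_le_one mult_left_le)
  qed
  define h where "h z = (\<Sum>n. complex_of_real (a n) * z ^ n)" for z
  have hs: "(\<lambda>n. complex_of_real (a n) * z ^ n) sums h z" if "norm z < 1" for z
    using smb[OF that] by (simp add: h_def summable_sums)
  have holh: "h holomorphic_on ball 0 1"
    by (rule power_series_holomorphic[where a = a]) (use hs in auto)
  have "h z - g z = 0" if "norm z < 1" for z
  proof (rule analytic_continuation[of "\<lambda>z. h z - g z" "ball 0 1" "of_real ` {0<..<1}" "1/2"])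
    show "(\<lambda>z. h z - g z) holomorphic_on ball 0 1"
      using holh hol by (intro holomorphic_intros) (auto intro: holomorphic_on_subset)
    show "complex_of_real ` {0<..<1} \<subseteq> ball 0 1" by auto
    have "(1/2::real) islimpt {0<..<1}"
      by (simp add: islimpt_greaterThanLessThan1 open_imp_islimpt)
    then have "complex_of_real (1/2) islimpt complex_of_real ` {0<..<1}"
      by (rule islimpt_isCont_image)
        (auto simp: eventually_at_filter simp del: of_real_divide intro!: always_eventually)
    then show "(1/2::complex) islimpt of_real ` {0<..<1::real}"
      by simp
    fix w :: complex assume "w \<in> of_real ` {0<..<1::real}"
    then obtain x :: real where x: "w = of_real x" "0 < x" "x < 1" by auto
    have "(\<lambda>n. complex_of_real (a n) * w ^ n) sums g w"
      using eq[OF x(2,3)] by (simp add: x)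
    then show "h w - g w = 0"
      using hs[of w] x by (auto dest: sums_unique2)
  qed (use that in auto)
  then have eq_hg: "h z = g z" if "norm z < 1" for z using that by simp
  have "eventually (\<lambda>w. w \<in> ball (0::complex) 1) (nhds 0)"
    by (intro eventually_nhds_in_open) auto
  then have "g has_fps_expansion Abs_fps (\<lambda>n. complex_of_real (a n))"
    by (intro has_fps_expansionI) (use hs eq_hg in \<open>auto elim!: eventually_mono\<close>)
  then show ?thesis
    using has_fps_expansion_imp_sums_complex[of g _ \<infinity> z] hol by fastforce
qed

section \<open>Entire Laplace transforms and infinite divisibility\<close>

lemma exp_abs_le_add: "exp \<bar>x\<bar> \<le> exp x + exp (- x)" for x :: real
  by (cases "0 \<le> x") auto

lemma norm_exp_mult_of_real: "norm (exp (z * complex_of_real y)) = exp (Re z * y)"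
  by simp

lemma integrable_cexp:
  assumes [measurable]: "f \<in> borel_measurable M" and "integrable M (\<lambda>y. exp (Re z * f y))"
  shows "integrable M (\<lambda>y. exp (z * complex_of_real (f y)))"
  by (rule Bochner_Integration.integrable_bound[OF assms(2)]) (auto simp: norm_exp_mult_of_real)

text \<open>Termwise integration of the exponential series. Moments at x and -x together control E
  exp(|x| |f|), which dominates all partial sums, so the transform is a power series with infinite
  radius of convergence.\<close>

lemma holomorphic_exp_moments:
  assumes [measurable]: "f \<in> borel_measurable M"
    and int: "\<And>x. integrable M (\<lambda>y. exp (x * f y))"
  shows "(\<lambda>z. LINT y|M. exp (z * complex_of_real (f y))) holomorphic_on UNIV"
proof -
  have abs_int: "integrable M (\<lambda>y. exp (\<bar>x\<bar> * \<bar>f y\<bar>))" for x :: real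
    by (rule Bochner_Integration.integrable_bound[OF Bochner_Integration.integrable_add[OF int[of x] int[of "-x"]]])
      (use exp_abs_le_add in \<open>auto simp: abs_mult[symmetric]\<close>)
  have ps: "(\<lambda>n. (LINT y|M. complex_of_real (f y) ^ n / fact n) * z ^ n)
      sums (LINT y|M. exp (z * complex_of_real (f y)))" for z
  proof -
    define h where "h n y = (z * complex_of_real (f y)) ^ n / fact n" for n y
    have h_sums: "(\<lambda>n. h n y) sums exp (z * complex_of_real (f y))" for y
      using exp_converges[of "z * complex_of_real (f y)"]
      by (simp add: h_def scaleR_conv_of_real field_simps)
    have norm_sums: "(\<lambda>n. norm (h n y)) sums exp (norm z * \<bar>f y\<bar>)" for y
      using exp_converges[of "norm z * \<bar>f y\<bar>"]
      by (simp add: h_def norm_divide norm_mult norm_power field_simps)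
    have [measurable]: "h n \<in> borel_measurable M" for n
      unfolding h_def by measurable
    have int_exp: "integrable M (\<lambda>y. exp (norm z * \<bar>f y\<bar>))"
      using abs_int[of "norm z"] by simp
    have sum_le: "(\<Sum>n<k. norm (h n y)) \<le> exp (norm z * \<bar>f y\<bar>)" for k y
      using norm_sums[of y] by (metis norm_ge_zero sum_le_suminf sums_iff finite_lessThan)
    have int_h: "integrable M (h n)" for n
    proof (rule Bochner_Integration.integrable_bound[OF int_exp])
      have "norm (h n y) \<le> exp (norm z * \<bar>f y\<bar>)" for y
        using sum_le[where k = "Suc n" and y = y] sum_nonneg[of "{..<n}" "\<lambda>n. norm (h n y)"]
        by (simp only: sum.lessThan_Suc) force
      then show "AE y in M. norm (h n y) \<le> norm (exp (norm z * \<bar>f y\<bar>))" by simp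
    qed measurable
    have "(\<lambda>n. LINT y|M. h n y) sums (LINT y|M. (\<Sum>n. h n y))"
    proof (rule sums_integral[OF int_h])
      show "AE y in M. summable (\<lambda>i. norm (h i y))"
        using norm_sums by (auto simp: sums_iff)
      show "summable (\<lambda>i. LINT y|M. norm (h i y))"
      proof (rule summableI_nonneg_bounded)
        fix k
        have "(\<Sum>i<k. LINT y|M. norm (h i y)) = (LINT y|M. (\<Sum>i<k. norm (h i y)))"
          using int_h by (simp add: Bochner_Integration.integral_sum)
        also have "\<dots> \<le> (LINT y|M. exp (norm z * \<bar>f y\<bar>))"
          using int_h int_exp sum_le by (intro integral_mono) auto
        finally show "(\<Sum>i<k. LINT y|M. norm (h i y)) \<le> (LINT y|M. exp (norm z * \<bar>f y\<bar>))" .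
      qed simp
    qed
    moreover have "(\<Sum>n. h n y) = exp (z * complex_of_real (f y))" for y
      using h_sums[of y] by (simp add: sums_iff)
    moreover have "(LINT y|M. h n y) = (LINT y|M. complex_of_real (f y) ^ n / fact n) * z ^ n" for n
    proof -
      have "h n y = complex_of_real (f y) ^ n / fact n * z ^ n" for y
        by (simp add: h_def power_mult_distrib)
      then show ?thesis by (simp only: integral_mult_left_zero)
    qed
    ultimately show ?thesis by simp
  qed
  have "(\<lambda>z. LINT y|M. exp (z * complex_of_real (f y))) holomorphic_on ball 0 r" for r
    by (rule power_series_holomorphic[where a = "\<lambda>n. LINT y|M. complex_of_real (f y) ^ n / fact n"])
      (use ps in simp)
  then have "(\<lambda>z. LINT y|M. exp (z * complex_of_real (f y))) holomorphic_on (\<Union>r\<in>UNIV. ball 0 r)"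
    by (intro holomorphic_on_UN_open) auto
  moreover have "(\<Union>r\<in>UNIV. ball (0::complex) r) = UNIV"
    using gt_ex by auto
  ultimately show ?thesis by simp
qed

text \<open>Formulated with the nonnegative integral, so that finiteness for the factors can later
  be read off from finiteness for the product.\<close>

lemma nn_integral_exp_convolution:
  fixes N M :: "real measure"
  assumes "finite_measure N" "finite_measure M" and [simp]: "sets N = sets borel" "sets M = sets borel"
  shows "(\<integral>\<^sup>+y. ennreal (exp (x * y)) \<partial>convolution N M)
    = (\<integral>\<^sup>+y. ennreal (exp (x * y)) \<partial>N) * (\<integral>\<^sup>+y. ennreal (exp (x * y)) \<partial>M)"
proof -
  have [simp]: "space N = UNIV" "space M = UNIV"
    using sets_eq_imp_space_eq[of N borel] sets_eq_imp_space_eq[of M borel] by auto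
  have [measurable_cong]: "sets N = sets borel" "sets M = sets borel" by simp_all
  have "(\<integral>\<^sup>+y. ennreal (exp (x * y)) \<partial>convolution N M)
      = (\<integral>\<^sup>+a. \<integral>\<^sup>+b. ennreal (exp (x * a)) * ennreal (exp (x * b)) \<partial>M \<partial>N)"
    by (subst nn_integral_convolution) (use assms in \<open>auto simp: distrib_left exp_add ennreal_mult\<close>)
  also have "\<dots> = (\<integral>\<^sup>+a. ennreal (exp (x * a)) * (\<integral>\<^sup>+b. ennreal (exp (x * b)) \<partial>M) \<partial>N)"
    by (intro nn_integral_cong nn_integral_cmult) measurable
  also have "\<dots> = (\<integral>\<^sup>+y. ennreal (exp (x * y)) \<partial>N) * (\<integral>\<^sup>+y. ennreal (exp (x * y)) \<partial>M)"
    by (intro nn_integral_multc) measurable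
  finally show ?thesis .
qed

lemma real_distribution_convolution:
  assumes "real_distribution N" "real_distribution M"
  shows "real_distribution (convolution N M)"
proof -
  interpret N: real_distribution N by fact
  interpret M: real_distribution M by fact
  interpret NM: pair_prob_space N M ..
  have "(\<lambda>(x, y). x + y) \<in> borel_measurable (N \<Otimes>\<^sub>M M)"
    by measurable
  then show ?thesis
    unfolding convolution_def real_distribution_def real_distribution_axioms_def
    by (auto intro: NM.prob_space_distr)
qed

lemma integral_convolution_cexp:
  fixes z :: complex
  assumes "real_distribution N" "real_distribution M"
    and int: "integrable N (\<lambda>y. exp (Re z * y))" "integrable M (\<lambda>y. exp (Re z * y))"
  shows "(LINT y|convolution N M. exp (z * complex_of_real y))
    = (LINT y|N. exp (z * complex_of_real y)) * (LINT y|M. exp (z * complex_of_real y))"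
proof -
  interpret N: real_distribution N by fact
  interpret M: real_distribution M by fact
  interpret NM: pair_sigma_finite N M ..
  have i: "integrable N (\<lambda>y. exp (z * complex_of_real y))" "integrable M (\<lambda>y. exp (z * complex_of_real y))"
    using int by (auto intro!: integrable_cexp)
  have "integrable (N \<Otimes>\<^sub>M M) (\<lambda>(a, b). exp (z * complex_of_real a) * exp (z * complex_of_real b))"
  proof (rule NM.Fubini_integrable)
    show "AE a in N. integrable M (\<lambda>b. (\<lambda>(a, b). exp (z * complex_of_real a) * exp (z * complex_of_real b)) (a, b))"
      using i by simp
    have "integrable N (\<lambda>a. norm (exp (z * complex_of_real a)) * (LINT b|M. norm (exp (z * complex_of_real b))))"
      using i(1) by (intro integrable_mult_left integrable_norm)
    then show "integrable N (\<lambda>a. LINT b|M. norm ((\<lambda>(a, b). exp (z * complex_of_real a) * exp (z * complex_of_real b)) (a, b)))"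
      by (simp add: norm_mult del: norm_exp_eq_Re)
  qed measurable
  from NM.integral_fst[OF this] i
  have "(LINT p|(N \<Otimes>\<^sub>M M). exp (z * complex_of_real (fst p)) * exp (z * complex_of_real (snd p)))
    = (LINT y|N. exp (z * complex_of_real y)) * (LINT y|M. exp (z * complex_of_real y))"
    by (simp add: case_prod_unfold)
  moreover have "(\<lambda>(x, y). x + y) \<in> borel_measurable (N \<Otimes>\<^sub>M M)"
    by measurable
  ultimately show ?thesis
    unfolding convolution_def
    by (subst integral_distr) (auto simp: case_prod_unfold distrib_left exp_add)
qed

lemma real_distribution_return: "real_distribution (return borel a)"
  by (simp add: real_distribution_def real_distribution_axioms_def prob_space_return)

lemma real_distribution_convolution_power:
  "real_distribution N \<Longrightarrow> real_distribution ((convolution N ^^ n) (return borel 0))"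
  by (induction n) (auto intro: real_distribution_convolution real_distribution_return)

lemma nn_integral_exp_convolution_power:
  assumes "real_distribution N"
  shows "(\<integral>\<^sup>+y. ennreal (exp (x * y)) \<partial>(convolution N ^^ n) (return borel 0))
    = (\<integral>\<^sup>+y. ennreal (exp (x * y)) \<partial>N) ^ n"
proof (induction n)
  case (Suc n)
  interpret N: real_distribution N by fact
  interpret Q: real_distribution "(convolution N ^^ n) (return borel 0)"
    by (rule real_distribution_convolution_power) fact
  show ?case
    using Suc by (simp add: nn_integral_exp_convolution N.finite_measure_axioms Q.finite_measure_axioms)
qed (simp add: nn_integral_return)

lemma integral_cexp_convolution_power:
  assumes "real_distribution N" and int: "\<And>x. integrable N (\<lambda>y. exp (x * y))"
  shows "(LINT y|(convolution N ^^ n) (return borel 0). exp (z * complex_of_real y))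
         = (LINT y|N. exp (z * complex_of_real y)) ^ n"
proof -
  interpret N: real_distribution N by fact
  have fin: "integrable ((convolution N ^^ n) (return borel 0)) (\<lambda>y. exp (x * y))" for n x
  proof -
    interpret Q: real_distribution "(convolution N ^^ n) (return borel 0)"
      by (rule real_distribution_convolution_power) fact
    have "(\<integral>\<^sup>+y. ennreal (exp (x * y)) \<partial>N) < \<infinity>"
      using int[of x] by (simp add: integrable_iff_bounded)
    then have "(\<integral>\<^sup>+y. ennreal (exp (x * y)) \<partial>N) ^ n < \<infinity>"
      by (simp add: power_less_top_ennreal)
    then show ?thesis
      by (simp add: integrable_iff_bounded nn_integral_exp_convolution_power[OF \<open>real_distribution N\<close>])
  qed
  show "(LINT y|(convolution N ^^ n) (return borel 0). exp (z * complex_of_real y))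
         = (LINT y|N. exp (z * complex_of_real y)) ^ n"
  proof (induction n)
    case (Suc n)
    have "(LINT y|convolution N ((convolution N ^^ n) (return borel 0)). exp (z * complex_of_real y))
      = (LINT y|N. exp (z * complex_of_real y))
        * (LINT y|(convolution N ^^ n) (return borel 0). exp (z * complex_of_real y))"
      by (rule integral_convolution_cexp)
        (simp_all add: assms fin real_distribution_convolution_power)
    with Suc show ?case by simp
  qed (simp add: integral_return)
qed

text \<open>By Tonelli the convolution roots of \<open>\<mu>\<close> inherit the exponential moments, so no information
  on their support is needed to see that their transforms are entire.\<close>

lemma infinitely_divisible_imp_zero_free:
  assumes "infinitely_divisible \<mu>" and int: "\<And>x. integrable \<mu> (\<lambda>y. exp (x * y))"
  shows "(LINT y|\<mu>. exp (z * complex_of_real y)) \<noteq> 0"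
proof (rule zero_free_if_all_roots[where f = "\<lambda>z. LINT y|\<mu>. exp (z * complex_of_real y)"])
  interpret real_distribution \<mu> using assms(1) by (simp add: infinitely_divisible_def)
  \<comment> \<open>At 0 the transform is the total mass 1, so it does not vanish
    identically.\<close>
  show "(LINT y|\<mu>. exp (0 * complex_of_real y)) \<noteq> 0" using prob_space by simp
  fix n :: nat assume n: "1 \<le> n"
  then obtain \<nu> where \<nu>: "real_distribution \<nu>" "\<mu> = (convolution \<nu> ^^ n) (return borel 0)"
    using assms(1) by (auto simp: infinitely_divisible_def)
  interpret \<nu>: real_distribution \<nu> by fact
  have int_\<nu>: "integrable \<nu> (\<lambda>y. exp (x * y))" for x
  proof -
    have "(\<integral>\<^sup>+y. ennreal (exp (x * y)) \<partial>\<nu>) ^ n < \<infinity>"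
      using int[of x] unfolding integrable_iff_bounded
      by (simp add: \<nu>(2) nn_integral_exp_convolution_power[OF \<nu>(1)])
    \<comment> \<open>Here 1 \<le> n matters: if a power with positive exponent is finite, so is its
      base, whereas a zeroth power is always 1.\<close>
    then have "(\<integral>\<^sup>+y. ennreal (exp (x * y)) \<partial>\<nu>) < \<infinity>"
      using n by (simp add: power_less_top_ennreal)
    then show ?thesis by (simp add: integrable_iff_bounded)
  qed
  show "\<exists>g. g holomorphic_on UNIV \<and> (\<forall>z. (LINT y|\<mu>. exp (z * complex_of_real y)) = g z ^ n)"
    using holomorphic_exp_moments[of "\<lambda>y. y" \<nu>] int_\<nu>
      integral_cexp_convolution_power[OF \<nu>(1) int_\<nu>] \<nu>(2)
    by auto
qed

text \<open>If nonconstant, \<open>q\<close> would have a negative leading coefficient and decay at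
  least linearly, against the lower bound for small \<epsilon>.\<close>

lemma nonpos_sublinear_poly_constant:
  fixes q :: "real poly"
  assumes le0: "\<And>x. 0 \<le> x \<Longrightarrow> poly q x \<le> 0"
    and ge: "\<And>\<epsilon>. 0 < \<epsilon> \<Longrightarrow> \<exists>K. \<forall>x\<ge>0. - \<epsilon> * x - K \<le> poly q x"
  shows "degree q = 0"
proof (rule ccontr)
  assume deg: "degree q \<noteq> 0"
  have "lead_coeff q \<le> 0"
  proof (rule ccontr)
    assume "\<not> lead_coeff q \<le> 0"
    with poly_pinfty_gt_lc[of q] obtain n where "\<forall>x\<ge>n. lead_coeff q \<le> poly q x" by auto
    then have "lead_coeff q \<le> poly q (max n 0)" by simp
    with le0[of "max n 0"] \<open>\<not> lead_coeff q \<le> 0\<close> show False by simp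
  qed
  then have neg: "lead_coeff q < 0" using deg by (metis degree_0 leading_coeff_0_iff order_le_less)
  \<comment> \<open>Writing -q(x) = a + x r(x) isolates the slope: r is eventually at least its
    leading coefficient l, and the lower bound on \<open>q\<close> is used with slope l/2.\<close>
  obtain a r where q: "- q = pCons a r" by (cases "- q") auto
  have "r \<noteq> 0" using q deg by (metis degree_minus degree_pCons_eq_if)
  then have l: "lead_coeff r = - lead_coeff q"
    using q by (metis degree_minus lead_coeff_minus lead_coeff_pCons(1))
  define l where "l = lead_coeff r"
  have "0 < l" using l neg by (simp add: l_def)
  then obtain n where n: "\<And>x. n \<le> x \<Longrightarrow> l \<le> poly r x"
    using poly_pinfty_gt_lc[of r] by (auto simp: l_def)
  obtain K where K: "\<And>x. 0 \<le> x \<Longrightarrow> - (l / 2) * x - K \<le> poly q x"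
    using ge[of "l / 2"] \<open>0 < l\<close> by auto
  \<comment> \<open>Chosen beyond n and so large that l x / 2 exceeds K - a, where the two bounds on
    \<open>poly q x\<close> collide.\<close>
  define x where "x = max (max n 0) (2 * (K - a + 1) / l)"
  have x: "n \<le> x" "0 \<le> x" "2 * (K - a + 1) / l \<le> x" by (auto simp: x_def)
  have "poly q x = - a - x * poly r x"
    using arg_cong[OF q, of "\<lambda>p. poly p x"] by simp
  also have "\<dots> \<le> - a - x * l"
    using n[OF x(1)] x(2) by (simp add: mult_left_mono)
  finally have "- (l / 2) * x - K \<le> - a - x * l" using K[OF x(2)] by linarith
  moreover have "K - a + 1 \<le> l * x / 2"
    using x(3) \<open>0 < l\<close> by (simp add: field_simps)
  ultimately show False by (simp add: algebra_simps)
qed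

lemma poly_map_poly_Re: "poly (map_poly Re p) x = Re (poly p (of_real x))"
proof (induction p)
  case (pCons a p)
  then show ?case by (simp add: map_poly_pCons)
qed simp

text \<open>Without zeros the transform is \<open>exp p\<close> for a polynomial \<open>p\<close>. On the negative half-line it is
  at most 1, and it decays subexponentially because \<open>f\<close> charges every neighbourhood of 0; so
  \<open>p\<close> is constant and \<open>f = 0\<close> almost surely.\<close>

lemma exp_moment_has_zero:
  assumes "prob_space M" and [measurable]: "f \<in> borel_measurable M" and nonneg: "\<And>y. y \<in> space M \<Longrightarrow> 0 \<le> f y"
    and int: "\<And>x. integrable M (\<lambda>y. exp (x * f y))"
    and "0 < C" and bound: "\<And>x. 0 \<le> x \<Longrightarrow> (LINT y|M. exp (x * f y)) \<le> exp (C * (1 + x) ^ m)"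
    and not_0: "\<not> (AE y in M. f y = 0)"
    and small: "\<And>\<epsilon>. 0 < \<epsilon> \<Longrightarrow> 0 < measure M {y \<in> space M. f y \<le> \<epsilon>}"
  shows "\<exists>z. Im z \<noteq> 0 \<and> (LINT y|M. exp (z * complex_of_real (f y))) = 0"
proof -
  interpret prob_space M by fact
  define F where "F z = (LINT y|M. exp (z * complex_of_real (f y)))" for z
  define \<phi> where "\<phi> x = (LINT y|M. exp (x * f y))" for x
  have F_real: "F (of_real x) = of_real (\<phi> x)" for x
    unfolding F_def \<phi>_def by (simp add: exp_of_real flip: of_real_mult)
  \<comment> \<open>Restriction of the integral to the event f \<le> \<epsilon>. The probability of
    the event is a constant factor, so the rate of decay in x is at most \<epsilon>.\<close>
  have lower: "exp (- \<epsilon> * x) * measure M {y \<in> space M. f y \<le> \<epsilon>} \<le> \<phi> (- x)" if "0 \<le> x" for x \<epsilon>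
  proof -
    have "(LINT y|M. exp (- \<epsilon> * x) * indicator {y \<in> space M. f y \<le> \<epsilon>} y) \<le> \<phi> (- x)"
      unfolding \<phi>_def
    proof (intro integral_mono int)
      show "integrable M (\<lambda>y. exp (- \<epsilon> * x) * indicator {y \<in> space M. f y \<le> \<epsilon>} y)"
        by (intro integrable_mult_right integrable_real_indicator) (auto simp: emeasure_eq_measure)
      show "exp (- \<epsilon> * x) * indicator {y \<in> space M. f y \<le> \<epsilon>} y \<le> exp (- x * f y)" for y
        using that mult_right_mono[of "f y" \<epsilon> x] by (auto simp: indicator_def mult.commute)
    qed
    then show ?thesis by simp
  qed
  \<comment> \<open>Positivity on the real line serves twice: logarithms of \<phi> may be taken, and
    no zero of \<open>F\<close> is real.\<close>
  have pos: "0 < \<phi> x" for x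
  proof (rule ccontr)
    assume "\<not> 0 < \<phi> x"
    moreover have "0 \<le> \<phi> x" by (simp add: \<phi>_def)
    ultimately have "\<phi> x = 0" by simp
    then have "AE y in M. exp (x * f y) = 0"
      unfolding \<phi>_def by (subst (asm) integral_nonneg_eq_0_iff_AE) (auto intro: int)
    then show False by (simp add: AE_False)
  qed
  have le1: "\<phi> (- x) \<le> 1" if "0 \<le> x" for x
  proof -
    have "\<phi> (- x) \<le> (LINT y|M. 1)"
      unfolding \<phi>_def using nonneg that by (intro integral_mono int) auto
    then show ?thesis by (simp add: prob_space)
  qed
  have hol: "F holomorphic_on UNIV"
    unfolding F_def by (rule holomorphic_exp_moments) (auto intro: int)
  have F_bound: "norm (F z) \<le> exp (C * (1 + norm z) ^ m)" for z
  proof -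
    have "norm (F z) \<le> (LINT y|M. norm (exp (z * complex_of_real (f y))))"
      unfolding F_def by (rule integral_norm_bound)
    also have "\<dots> \<le> (LINT y|M. exp (norm z * f y))"
      using nonneg complex_Re_le_cmod int
      by (intro integral_mono integrable_norm integrable_cexp) (auto intro: mult_right_mono)
    also have "\<dots> \<le> exp (C * (1 + norm z) ^ m)" by (rule bound) simp
    finally show ?thesis .
  qed
  have "\<exists>z. F z = 0"
  proof (rule ccontr)
    assume "\<nexists>z. F z = 0"
    then obtain p where p: "\<And>z. F z = exp (poly p z)"
      using zero_free_finite_order_imp_exp_poly[OF hol _ \<open>0 < C\<close> F_bound] by auto
    \<comment> \<open>The real part of the exponent along the negative half-line, reflected to x
      \<ge> 0.\<close>
    define q where "q = pcompose (map_poly Re p) [:0, -1:]"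
    have q: "poly q x = ln (\<phi> (- x))" for x
    proof -
      have "norm (F (of_real (- x))) = exp (Re (poly p (of_real (- x))))"
        by (simp add: p)
      then have "\<phi> (- x) = exp (poly q x)"
        using pos[of "- x"] unfolding F_real by (simp add: q_def poly_pcompose poly_map_poly_Re)
      then show ?thesis by simp
    qed
    have "degree q = 0"
    proof (rule nonpos_sublinear_poly_constant)
      show "poly q x \<le> 0" if "0 \<le> x" for x
        using le1[OF that] pos[of "- x"] by (simp add: q)
      fix \<epsilon> :: real assume \<epsilon>: "0 < \<epsilon>"
      have "- \<epsilon> * x + ln (measure M {y \<in> space M. f y \<le> \<epsilon>}) \<le> poly q x" if "0 \<le> x" for x
      proof -
        have "ln (exp (- \<epsilon> * x) * measure M {y \<in> space M. f y \<le> \<epsilon>}) \<le> poly q x"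
          unfolding q using lower[OF that] small[OF \<epsilon>] pos by (subst ln_le_cancel_iff) auto
        then show ?thesis
          using small[OF \<epsilon>] by (simp add: ln_mult)
      qed
      then show "\<exists>K. \<forall>x\<ge>0. - \<epsilon> * x - K \<le> poly q x"
        by (intro exI[of _ "- ln (measure M {y \<in> space M. f y \<le> \<epsilon>})"]) auto
    qed
    then obtain c where "q = [:c:]" by (metis degree_eq_zeroE)
    \<comment> \<open>A constant \<open>q\<close> forces E exp(-f) = 1, whereas f is nonnegative and
      not almost surely 0.\<close>
    then have "ln (\<phi> (- 1)) = ln (\<phi> (- 0))" using q[of 1] q[of 0] by simp
    moreover have "\<phi> (- 0) = 1" by (simp add: \<phi>_def prob_space)
    ultimately have "\<phi> (- 1) = 1" using pos[of "- 1"] by simp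
    then have "(LINT y|M. 1 - exp (- f y)) = 0"
      using int[of "-1"] by (simp add: \<phi>_def prob_space)
    then have "AE y in M. 1 - exp (- f y) = 0"
      using int[of "-1"] nonneg by (subst (asm) integral_nonneg_eq_0_iff_AE) auto
    then show False using not_0 by simp
  qed
  then obtain z where z: "F z = 0" by blast
  have "Im z \<noteq> 0"
  proof
    assume "Im z = 0"
    then have "z = of_real (Re z)" by (simp add: complex_eq_iff)
    then have "F z = of_real (\<phi> (Re z))" using F_real by metis
    with z pos[of "Re z"] show False by simp
  qed
  with z show ?thesis by (auto simp: F_def)
qed

section \<open>Random indices and independence\<close>

text \<open>The random element at the random index is the sum over n of the indicator of K = n times
  \<open>Z n\<close>. For each outcome at most one term is nonzero, so only summability of the
  integrated norms must be checked to exchange sum and integral.\<close>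

lemma random_index_sums:
  fixes Z :: "nat \<Rightarrow> 'a \<Rightarrow> 'b :: {banach, second_countable_topology}" and K :: "'a \<Rightarrow> nat"
  assumes int: "\<And>n. integrable M (\<lambda>\<omega>. indicator {n} (K \<omega>) *\<^sub>R Z n \<omega>)"
    and smb: "summable (\<lambda>n. LINT \<omega>|M. norm (indicator {n} (K \<omega>) *\<^sub>R Z n \<omega>))"
  shows "integrable M (\<lambda>\<omega>. Z (K \<omega>) \<omega>)"
    and "(\<lambda>n. LINT \<omega>|M. indicator {n} (K \<omega>) *\<^sub>R Z n \<omega>) sums (LINT \<omega>|M. Z (K \<omega>) \<omega>)"
proof -
  have fin: "(\<lambda>n. indicator {n} (K \<omega>) *\<^sub>R Z n \<omega>) sums Z (K \<omega>) \<omega>" for \<omega>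
    using sums_single[of "K \<omega>" "\<lambda>n. Z n \<omega>"]
    by (rule back_subst[of "\<lambda>f. f sums _"]) (auto simp: indicator_def)
  then have sum_eq: "(\<Sum>n. indicator {n} (K \<omega>) *\<^sub>R Z n \<omega>) = Z (K \<omega>) \<omega>" for \<omega>
    by (simp add: sums_iff)
  have smb_norm: "AE \<omega> in M. summable (\<lambda>n. norm (indicator {n} (K \<omega>) *\<^sub>R Z n \<omega>))"
  proof (rule AE_I2)
    show "summable (\<lambda>n. norm (indicator {n} (K \<omega>) *\<^sub>R Z n \<omega>))" for \<omega>
      by (rule summable_finite[of "{K \<omega>}"]) (auto simp: indicator_def)
  qed
  show "integrable M (\<lambda>\<omega>. Z (K \<omega>) \<omega>)"
    using integrable_suminf[OF int smb_norm smb] by (simp add: sum_eq)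
  show "(\<lambda>n. LINT \<omega>|M. indicator {n} (K \<omega>) *\<^sub>R Z n \<omega>) sums (LINT \<omega>|M. Z (K \<omega>) \<omega>)"
    using sums_integral[OF int smb_norm smb] by (simp add: sum_eq)
qed

context prob_space begin

section \<open>Expectations at an integer-valued random index\<close>

lemma summable_prob_nat:
  fixes K :: "'a \<Rightarrow> nat"
  assumes [measurable]: "K \<in> measurable M (count_space UNIV)"
  shows "summable (\<lambda>n. prob {\<omega> \<in> space M. K \<omega> = n})"
proof -
  have "(\<lambda>n. prob (K -` {n} \<inter> space M)) sums prob (\<Union>n. K -` {n} \<inter> space M)"
    by (intro finite_measure_UNION) (auto simp: disjoint_family_on_def)
  moreover have "K -` {n} \<inter> space M = {\<omega> \<in> space M. K \<omega> = n}" for n by auto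
  ultimately show ?thesis by (simp add: sums_iff)
qed

lemma integral_indicator_index:
  fixes K :: "'a \<Rightarrow> nat"
  assumes [measurable]: "K \<in> measurable M (count_space UNIV)"
  shows "(LINT \<omega>|M. indicator {n} (K \<omega>) :: real) = prob {\<omega> \<in> space M. K \<omega> = n}"
proof -
  have "(LINT \<omega>|M. indicator {n} (K \<omega>) :: real) = (LINT \<omega>|M. indicator {\<omega> \<in> space M. K \<omega> = n} \<omega>)"
    by (intro Bochner_Integration.integral_cong) (auto simp: indicator_def)
  then show ?thesis by simp
qed

text \<open>The case of constant \<open>Z n\<close>. The value type is general because both real and
  complex powers occur; the integrability part later yields exponential moments.\<close>

lemma expectation_nat_sums:
  fixes K :: "'a \<Rightarrow> nat" and h :: "nat \<Rightarrow> 'b :: {banach, second_countable_topology}"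
  assumes K [measurable]: "K \<in> measurable M (count_space UNIV)"
    and smb: "summable (\<lambda>n. prob {\<omega> \<in> space M. K \<omega> = n} * norm (h n))"
  shows "integrable M (\<lambda>\<omega>. h (K \<omega>))"
    and "(\<lambda>n. prob {\<omega> \<in> space M. K \<omega> = n} *\<^sub>R h n) sums expectation (\<lambda>\<omega>. h (K \<omega>))"
proof -
  have int_ind: "integrable M (\<lambda>\<omega>. indicator {n} (K \<omega>) :: real)" for n
    by (rule integrable_const_bound[of _ 1]) (auto simp: indicator_def)
  then have int: "integrable M (\<lambda>\<omega>. indicator {n} (K \<omega>) *\<^sub>R h n)" for n
    by (intro integrable_scaleR_left)
  have eq: "(LINT \<omega>|M. indicator {n} (K \<omega>) *\<^sub>R h n) = prob {\<omega> \<in> space M. K \<omega> = n} *\<^sub>R h n" for n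
    using integral_indicator_index[OF K, of n] int_ind[of n] by (subst integral_scaleR_left) auto
  have norm_eq: "(LINT \<omega>|M. norm (indicator {n} (K \<omega>) *\<^sub>R h n)) = prob {\<omega> \<in> space M. K \<omega> = n} * norm (h n)" for n
    by (simp add: integral_indicator_index[OF K] del: indicator_simps of_bool_eq flip: indicator_def)
  have smb': "summable (\<lambda>n. LINT \<omega>|M. norm (indicator {n} (K \<omega>) *\<^sub>R h n))"
    unfolding norm_eq by (rule smb)
  show "integrable M (\<lambda>\<omega>. h (K \<omega>))"
    by (rule random_index_sums(1)[of M K "\<lambda>n _. h n", OF int smb'])
  show "(\<lambda>n. prob {\<omega> \<in> space M. K \<omega> = n} *\<^sub>R h n) sums expectation (\<lambda>\<omega>. h (K \<omega>))"
    using random_index_sums(2)[of M K "\<lambda>n _. h n", OF int smb'] by (simp add: eq)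
qed

text \<open>Conditioning on the index. Independence enters as the product formula on each event K =
  n, and the bound 1 lets the probabilities P(K = n) dominate the series.\<close>

lemma expectation_random_index:
  fixes K :: "'a \<Rightarrow> nat" and Z :: "nat \<Rightarrow> 'a \<Rightarrow> real"
  assumes K [measurable]: "K \<in> measurable M (count_space UNIV)"
    and [measurable]: "\<And>n. Z n \<in> borel_measurable M"
    and bound: "\<And>n \<omega>. \<bar>Z n \<omega>\<bar> \<le> 1"
    and indep: "\<And>n. expectation (\<lambda>\<omega>. indicator {n} (K \<omega>) * Z n \<omega>)
      = expectation (\<lambda>\<omega>. indicator {n} (K \<omega>)) * expectation (Z n)"
  shows "expectation (\<lambda>\<omega>. Z (K \<omega>) \<omega>) = expectation (\<lambda>\<omega>. expectation (Z (K \<omega>)))"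
proof -
  have c: "\<bar>expectation (Z n)\<bar> \<le> 1" for n
  proof -
    have "\<bar>expectation (Z n)\<bar> \<le> expectation (\<lambda>\<omega>. \<bar>Z n \<omega>\<bar>)" by (rule integral_abs_bound)
    also have "\<dots> \<le> expectation (\<lambda>\<omega>. 1)"
      using bound by (intro integral_mono integrable_const_bound[of _ 1]) auto
    finally show ?thesis by (simp add: prob_space)
  qed
  have le: "\<bar>indicator {n} (K \<omega>) * Z n \<omega>\<bar> \<le> indicator {n} (K \<omega>)" for n \<omega>
    using bound[of n \<omega>] by (auto simp: indicator_def)
  have int_ind: "integrable M (\<lambda>\<omega>. indicator {n} (K \<omega>) :: real)" for n
    by (rule integrable_const_bound[of _ 1]) (auto simp: indicator_def)
  have int: "integrable M (\<lambda>\<omega>. indicator {n} (K \<omega>) * Z n \<omega>)" for n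
    by (rule integrable_const_bound[of _ 1]) (use bound in \<open>auto simp: indicator_def\<close>)
  have "summable (\<lambda>n. LINT \<omega>|M. norm (indicator {n} (K \<omega>) *\<^sub>R Z n \<omega>))"
  proof (rule summable_comparison_test'[OF summable_prob_nat[OF K], of 0])
    fix n
    have "(LINT \<omega>|M. \<bar>indicator {n} (K \<omega>) * Z n \<omega>\<bar>) \<le> (LINT \<omega>|M. indicator {n} (K \<omega>))"
      by (rule integral_mono[OF integrable_abs[OF int] int_ind le])
    then show "norm (LINT \<omega>|M. norm (indicator {n} (K \<omega>) *\<^sub>R Z n \<omega>)) \<le> prob {\<omega> \<in> space M. K \<omega> = n}"
      by (simp add: integral_indicator_index[OF K])
  qed
  with random_index_sums(2)[of M K Z] int
  have 1: "(\<lambda>n. LINT \<omega>|M. indicator {n} (K \<omega>) * Z n \<omega>) sums expectation (\<lambda>\<omega>. Z (K \<omega>) \<omega>)"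
    by simp
  have "(\<lambda>n. prob {\<omega> \<in> space M. K \<omega> = n} *\<^sub>R expectation (Z n)) sums expectation (\<lambda>\<omega>. expectation (Z (K \<omega>)))"
  proof (rule expectation_nat_sums(2)[OF K])
    show "summable (\<lambda>n. prob {\<omega> \<in> space M. K \<omega> = n} * norm (expectation (Z n)))"
      by (rule summable_comparison_test'[OF summable_prob_nat[OF K], of 0])
        (use c in \<open>auto intro: mult_left_le\<close>)
  qed
  then have "(\<lambda>n. LINT \<omega>|M. indicator {n} (K \<omega>) * Z n \<omega>) sums expectation (\<lambda>\<omega>. expectation (Z (K \<omega>)))"
    by (simp add: indep integral_indicator_index[OF K])
  with 1 show ?thesis by (rule sums_unique2)
qed

section \<open>Product formula for independent random elements\<close>

lemma indep_elements_measurable: "indep_elements M S X T Z \<Longrightarrow> X \<in> measurable M S"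
  by (simp add: indep_elements_def)

text \<open>The events of f(X) and g(Z) are among those of X and Z, so they inherit independence,
  and expectations of independent real variables multiply.\<close>

lemma indep_elements_expectation_mult:
  fixes f :: "'b \<Rightarrow> real" and g :: "'c \<Rightarrow> real"
  assumes ind: "indep_elements M S X T Z"
    and f [measurable]: "f \<in> borel_measurable S" and g [measurable]: "g \<in> borel_measurable T"
    and "integrable M (\<lambda>\<omega>. f (X \<omega>))" "integrable M (\<lambda>\<omega>. g (Z \<omega>))"
  shows "expectation (\<lambda>\<omega>. f (X \<omega>) * g (Z \<omega>)) = expectation (\<lambda>\<omega>. f (X \<omega>)) * expectation (\<lambda>\<omega>. g (Z \<omega>))"
proof (rule indep_var_lebesgue_integral)
  have [measurable]: "X \<in> measurable M S" "Z \<in> measurable M T"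
    using ind by (auto simp: indep_elements_def)
  have "indep_set {(\<lambda>\<omega>. f (X \<omega>)) -` A \<inter> space M | A. A \<in> sets borel}
      {(\<lambda>\<omega>. g (Z \<omega>)) -` A \<inter> space M | A. A \<in> sets borel}"
  proof -
    have 1: "indep_set {X -` A \<inter> space M | A. A \<in> sets S} {Z -` B \<inter> space M | B. B \<in> sets T}"
      using ind by (simp add: indep_elements_def)
    have "(\<lambda>\<omega>. f (X \<omega>)) -` A \<inter> space M \<in> {X -` A \<inter> space M | A. A \<in> sets S}"
         "(\<lambda>\<omega>. g (Z \<omega>)) -` A \<inter> space M \<in> {Z -` A \<inter> space M | A. A \<in> sets T}"
      if "A \<in> sets borel" for A
    proof -
      have "(\<lambda>\<omega>. f (X \<omega>)) -` A \<inter> space M = X -` (f -` A \<inter> space S) \<inter> space M"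
        using measurable_space[of X M S] by auto
      then show "(\<lambda>\<omega>. f (X \<omega>)) -` A \<inter> space M \<in> {X -` A \<inter> space M | A. A \<in> sets S}"
        using measurable_sets[OF f that] by blast
      have "(\<lambda>\<omega>. g (Z \<omega>)) -` A \<inter> space M = Z -` (g -` A \<inter> space T) \<inter> space M"
        using measurable_space[of Z M T] by auto
      then show "(\<lambda>\<omega>. g (Z \<omega>)) -` A \<inter> space M \<in> {Z -` A \<inter> space M | A. A \<in> sets T}"
        using measurable_sets[OF g that] by blast
    qed
    with 1 show ?thesis
      unfolding indep_set_def by (elim indep_sets_mono_sets) (auto split: bool.splits)
  qed
  then have "indep_set (sigma_sets (space M) {(\<lambda>\<omega>. f (X \<omega>)) -` A \<inter> space M | A. A \<in> sets borel})
      (sigma_sets (space M) {(\<lambda>\<omega>. g (Z \<omega>)) -` A \<inter> space M | A. A \<in> sets borel})"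
    by (rule indep_set_sigma_sets) (auto simp: Int_stable_def intro: exI[of _ "_ \<inter> _"])
  then show "indep_var borel (\<lambda>\<omega>. f (X \<omega>)) borel (\<lambda>\<omega>. g (Z \<omega>))"
    by (simp add: indep_var_eq)
qed fact+

end

section \<open>Integer-valued limits and grid approximation from the right\<close>

lemma tendsto_real_eventually_eq:
  fixes k :: "'b \<Rightarrow> nat"
  assumes "((\<lambda>n. real (k n)) \<longlongrightarrow> real l) F"
  shows "eventually (\<lambda>n. k n = l) F"
  using tendstoD[OF assms zero_less_one] by eventually_elim (auto simp: dist_real_def)

text \<open>Adding 1 to the floor puts the grid point strictly above y and at most at y + 1/(n+1).
  Strictness is what makes it approach y within \<open>at_right\<close>.\<close>

lemma grid_tendsto_at_right:
  assumes "0 \<le> (y::real)"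
  shows "filterlim (\<lambda>n. (real (nat \<lfloor>real (Suc n) * y\<rfloor>) + 1) / real (Suc n)) (at_right y) sequentially"
proof -
  define q where "q n = (real (nat \<lfloor>real (Suc n) * y\<rfloor>) + 1) / real (Suc n)" for n
  have r: "real (nat \<lfloor>real (Suc n) * y\<rfloor>) = of_int \<lfloor>real (Suc n) * y\<rfloor>" for n
    using assms by (intro of_nat_nat) simp
  have 1: "y < q n" for n
  proof -
    have "real (Suc n) * y < of_int \<lfloor>real (Suc n) * y\<rfloor> + 1" by linarith
    then show ?thesis
      unfolding q_def r by (simp add: pos_less_divide_eq mult.commute del: of_nat_Suc)
  qed
  have 2: "q n \<le> y + 1 / real (Suc n)" for n
  proof -
    have "q n \<le> (real (Suc n) * y + 1) / real (Suc n)"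
      unfolding q_def r by (intro divide_right_mono) (simp_all del: of_nat_Suc)
    also have "\<dots> = y + 1 / real (Suc n)" by (simp add: add_divide_distrib)
    finally show ?thesis .
  qed
  have "q \<longlonglongrightarrow> y"
  proof (rule tendsto_sandwich[of "\<lambda>_. y" q _ "\<lambda>n. y + 1 / real (Suc n)"])
    show "(\<lambda>n. y + 1 / real (Suc n)) \<longlonglongrightarrow> y"
      using tendsto_add[OF tendsto_const lim_1_over_n[THEN LIMSEQ_Suc], of y] by simp
  qed (use 1 2 in \<open>auto intro: always_eventually less_imp_le\<close>)
  then have "filterlim q (at_right y) sequentially"
    using 1 by (auto simp: filterlim_at intro!: always_eventually dest: order.strict_implies_not_eq)
  then show ?thesis by (simp add: q_def[abs_def])
qed

section \<open>The inverse stable subordinator\<close>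

lemma first_passage_le:
  assumes "0 < x" "t < D x \<omega>"
  shows "first_passage D t \<omega> \<le> x"
  unfolding first_passage_def
  by (rule enn2real_leI) (use assms in \<open>auto intro: INF_lower2\<close>)

text \<open>The point x' keeps the infimum finite; for the empty set \<open>enn2real\<close> would
  return 0 and the bound could fail.\<close>

lemma le_first_passage:
  assumes "mono_on {0..} (\<lambda>t. D t \<omega>)" "0 \<le> x" "D x \<omega> \<le> t" and "0 < x'" "t < D x' \<omega>"
  shows "x \<le> first_passage D t \<omega>"
proof -
  have "x \<le> y" if "0 < y" "t < D y \<omega>" for y
    using monotone_onD[OF assms(1), of y x] that assms(2,3) by force
  then have "ennreal x \<le> (INF x\<in>{x. 0 < x \<and> D x \<omega> > t}. ennreal x)"
    by (intro INF_greatest) (auto intro!: ennreal_leI)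
  moreover have "(INF x\<in>{x. 0 < x \<and> D x \<omega> > t}. ennreal x) \<le> ennreal x'"
    using assms by (intro INF_lower) auto
  then have "(INF x\<in>{x. 0 < x \<and> D x \<omega> > t}. ennreal x) < top"
    using ennreal_less_top le_less_trans by blast
  ultimately have "enn2real (ennreal x) \<le> first_passage D t \<omega>"
    unfolding first_passage_def by (intro enn2real_mono)
  then show ?thesis using assms(2) by simp
qed

text \<open>On n < f \<le> n + 1 the integrand is at most exp(a (n + 1)), and the tail decays at
  rate 2a. What remains is a geometric series of ratio exp(-a), which is at most 1/2 since a \<ge>
  1.\<close>

lemma (in prob_space) exp_moment_le_tail_sum:
  assumes [measurable]: "f \<in> borel_measurable M" and "1 \<le> a" "0 \<le> B"
    and tail: "\<And>n::nat. measure M {y \<in> space M. real n < f y} \<le> B * exp (- 2 * a * real n)"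
  shows "integrable M (\<lambda>y. exp (a * f y))"
    and "(LINT y|M. exp (a * f y)) \<le> 1 + 2 * B * exp a"
proof -
  have geo: "(\<lambda>n. B * exp a * exp (- a) ^ n) sums (B * exp a * (1 / (1 - exp (- a))))"
    using \<open>1 \<le> a\<close> by (intro sums_mult geometric_sums) auto
  have "exp 1 \<le> exp a" using \<open>1 \<le> a\<close> by simp
  moreover have "(2::real) \<le> exp 1" using exp_ge_add_one_self[of 1] by simp
  ultimately have "2 \<le> exp a" by linarith
  then have "exp (- a) \<le> 1 / 2" by (simp add: exp_minus field_simps)
  then have geo_le: "1 / (1 - exp (- a)) \<le> 2" using frac_le[of 1 1 "1 / 2" "1 - exp (- a)"] by simp
  have pointwise: "ennreal (exp (a * f y))
      \<le> 1 + (\<Sum>n. ennreal (exp (a * (real n + 1))) * indicator {y \<in> space M. real n < f y} y)"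
    if "y \<in> space M" for y
  proof (cases "f y \<le> 0")
    case True
    then show ?thesis using \<open>1 \<le> a\<close> by (intro add_increasing2) (auto simp: mult_nonneg_nonpos)
  next
    case False
    \<comment> \<open>The index of the interval, open on the left and closed on the right, that
      contains \<open>f y\<close>; this matches the strict tail events.\<close>
    define n where "n = nat (\<lceil>f y\<rceil> - 1)"
    have n: "real n < f y" "f y \<le> real n + 1" using False by (auto simp: n_def) linarith+
    define g where "g i = ennreal (exp (a * (real i + 1))) * indicator {y \<in> space M. real i < f y} y" for i
    have "ennreal (exp (a * f y)) \<le> ennreal (exp (a * (real n + 1))) * indicator {y \<in> space M. real n < f y} y"
      using n that \<open>1 \<le> a\<close> by (auto intro!: ennreal_leI mult_left_mono)
    also have "\<dots> \<le> (\<Sum>n. ennreal (exp (a * (real n + 1))) * indicator {y \<in> space M. real n < f y} y)"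
    proof -
      have "g n \<le> (\<Sum>i. g i)"
        using sum_le_suminf[of g "{n}"] by simp
      then show ?thesis unfolding g_def[abs_def] .
    qed
    also have "\<dots> \<le> 1 + \<dots>" by simp
    finally show ?thesis .
  qed
  have "(\<integral>\<^sup>+y. ennreal (exp (a * f y)) \<partial>M)
      \<le> (\<integral>\<^sup>+y. 1 + (\<Sum>n. ennreal (exp (a * (real n + 1))) * indicator {y \<in> space M. real n < f y} y) \<partial>M)"
    by (intro nn_integral_mono pointwise)
  also have "\<dots> = 1 + (\<Sum>n. ennreal (exp (a * (real n + 1))) * emeasure M {y \<in> space M. real n < f y})"
    by (simp add: nn_integral_add nn_integral_suminf nn_integral_cmult emeasure_space_1)
  also have "\<dots> \<le> 1 + (\<Sum>n. ennreal (B * exp a * exp (- a) ^ n))"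
  proof (intro add_left_mono suminf_le)
    fix n
    have "exp (a * (real n + 1)) * measure M {y \<in> space M. real n < f y}
        \<le> exp (a * (real n + 1)) * (B * exp (- 2 * a * real n))"
      by (intro mult_left_mono tail) simp
    also have "\<dots> = B * exp a * exp (- a) ^ n"
      by (simp add: exp_of_nat_mult[symmetric] exp_add[symmetric] algebra_simps)
    finally show "ennreal (exp (a * (real n + 1))) * emeasure M {y \<in> space M. real n < f y}
        \<le> ennreal (B * exp a * exp (- a) ^ n)"
      by (simp add: emeasure_eq_measure ennreal_mult'[symmetric] ennreal_leI)
  qed auto
  also have "(\<Sum>n. ennreal (B * exp a * exp (- a) ^ n)) = ennreal (B * exp a * (1 / (1 - exp (- a))))"
    by (rule suminf_ennreal_eq[OF _ geo]) (use \<open>0 \<le> B\<close> in simp)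
  also have "1 + \<dots> \<le> ennreal (1 + 2 * B * exp a)"
  proof -
    have "B * exp a * (1 / (1 - exp (- a))) \<le> B * exp a * 2"
      using \<open>0 \<le> B\<close> by (intro mult_left_mono geo_le) simp
    then have "ennreal 1 + ennreal (B * exp a * (1 / (1 - exp (- a)))) \<le> ennreal 1 + ennreal (2 * B * exp a)"
      by (intro add_left_mono ennreal_leI) simp
    also have "\<dots> = ennreal (1 + 2 * B * exp a)"
      using \<open>0 \<le> B\<close> by (intro ennreal_plus[symmetric]) auto
    finally show ?thesis by simp
  qed
  finally have *: "(\<integral>\<^sup>+y. ennreal (exp (a * f y)) \<partial>M) \<le> ennreal (1 + 2 * B * exp a)" .
  then show int: "integrable M (\<lambda>y. exp (a * f y))"
    by (simp add: integrable_iff_bounded) (metis ennreal_less_top le_less_trans)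
  show "(LINT y|M. exp (a * f y)) \<le> 1 + 2 * B * exp a"
    using * int \<open>0 \<le> B\<close> by (simp add: nn_integral_eq_integral flip: ennreal_le_iff)
qed

context prob_space begin

section \<open>Laplace transform and tails of the stable subordinator\<close>

lemma stable_subordinator_measurable:
  "stable_subordinator M \<alpha> D \<Longrightarrow> 0 \<le> x \<Longrightarrow> D x \<in> borel_measurable M"
  by (simp add: stable_subordinator_def levy_process_def)

lemma stable_subordinator_laplace:
  "stable_subordinator M \<alpha> D \<Longrightarrow> 0 \<le> x \<Longrightarrow> 0 < s \<Longrightarrow> expectation (\<lambda>\<omega>. exp (- s * D x \<omega>)) = exp (- x * s powr \<alpha>)"
  unfolding stable_subordinator_def by blast

text \<open>The integral of a non-integrable function is 0 by convention, but the prescribed Laplace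
  transform is positive.\<close>

lemma stable_subordinator_integrable:
  assumes "stable_subordinator M \<alpha> D" "0 \<le> x" "0 < s"
  shows "integrable M (\<lambda>\<omega>. exp (- s * D x \<omega>))"
proof (rule ccontr)
  assume "\<not> ?thesis"
  then have "(LINT \<omega>|M. exp (- s * D x \<omega>)) = 0" by (rule not_integrable_integral_eq)
  moreover have "(LINT \<omega>|M. exp (- s * D x \<omega>)) = exp (- x * s powr \<alpha>)"
    by (rule stable_subordinator_laplace) fact+
  ultimately show False by simp
qed

text \<open>Chernoff bound: the indicator of D(x) \<le> t is at most exp(s (t - D(x))).\<close>

lemma stable_subordinator_lower_tail:
  assumes D: "stable_subordinator M \<alpha> D" "0 \<le> x" and "0 < s"
  shows "prob {\<omega> \<in> space M. D x \<omega> \<le> t} \<le> exp (s * t) * exp (- x * s powr \<alpha>)"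
proof -
  have [measurable]: "D x \<in> borel_measurable M" by (rule stable_subordinator_measurable) fact+
  have "(LINT \<omega>|M. indicator {\<omega> \<in> space M. D x \<omega> \<le> t} \<omega>) \<le> (LINT \<omega>|M. exp (s * t) * exp (- s * D x \<omega>))"
  proof (intro integral_mono integrable_mult_right stable_subordinator_integrable[OF D \<open>0 < s\<close>])
    show "integrable M (\<lambda>\<omega>. indicator {\<omega> \<in> space M. D x \<omega> \<le> t} \<omega> :: real)"
      by (intro integrable_real_indicator) (auto simp: emeasure_eq_measure)
    show "indicator {\<omega> \<in> space M. D x \<omega> \<le> t} \<omega> \<le> exp (s * t) * exp (- s * D x \<omega>)" for \<omega>
      using \<open>0 < s\<close> by (auto simp: indicator_def exp_add[symmetric] mult_left_mono)
  qed
  then show ?thesis using stable_subordinator_laplace[OF assms] by simp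
qed

text \<open>The Chernoff bound with s = 1 gives P(D(n) \<le> t) \<le> exp(t - n), which tends to 0.
  This rules out, almost surely, the empty infimum in \<open>first_passage\<close>.\<close>

lemma stable_subordinator_exceeds:
  assumes D: "stable_subordinator M \<alpha> D"
  shows "AE \<omega> in M. \<exists>x>0. t < D x \<omega>"
proof -
  have [measurable]: "D (real n) \<in> borel_measurable M" for n
    by (rule stable_subordinator_measurable[OF D]) simp
  define A where "A = {\<omega> \<in> space M. \<forall>n. D (real n) \<omega> \<le> t}"
  have [measurable]: "A \<in> sets M" unfolding A_def by measurable
  have "(\<lambda>n. exp t * exp (- 1) ^ n) \<longlonglongrightarrow> exp t * 0"
    by (intro tendsto_mult tendsto_const LIMSEQ_realpow_zero) auto
  moreover have "prob A \<le> exp t * exp (- 1) ^ n" for n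
  proof -
    have "prob A \<le> prob {\<omega> \<in> space M. D (real n) \<omega> \<le> t}"
      by (intro finite_measure_mono) (auto simp: A_def)
    also have "\<dots> \<le> exp t * exp (- 1) ^ n"
      using stable_subordinator_lower_tail[OF D, of "real n" 1 t] by (simp add: exp_of_nat_mult[symmetric])
    finally show ?thesis .
  qed
  ultimately have "prob A \<le> exp t * 0" by - (rule LIMSEQ_le_const, assumption, blast)
  then have "prob A = 0" by (simp add: measure_le_0_iff)
  then have "AE \<omega> in M. \<omega> \<notin> A"
    by (subst AE_iff_measurable[where N = A]) (auto simp: emeasure_eq_measure A_def)
  then show ?thesis using AE_space
  proof eventually_elim
    case (elim \<omega>)
    then obtain n where n: "t < D (real n) \<omega>" by (auto simp: A_def not_le)
    \<comment> \<open>The index n may be 0, while a positive time is wanted; monotonicity allows the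
      passage to n + 1.\<close>
    have "D (real n) \<omega> \<le> D (real (Suc n)) \<omega>"
      using D elim unfolding stable_subordinator_def
      by (intro monotone_onD[of "{0..}" "(\<le>)" "(\<le>)" "\<lambda>t. D t \<omega>"]) auto
    then show ?case using n by (intro exI[of _ "real (Suc n)"]) auto
  qed
qed

section \<open>The inverse subordinator at a fixed time\<close>

context
  fixes \<alpha> :: real and Y :: "real \<Rightarrow> 'a \<Rightarrow> real" and t :: real
  assumes alpha: "0 < \<alpha>" "\<alpha> < 1" and t: "0 < t"
    and inv: "inverse_stable_subordinator M \<alpha> Y" and Y_meas [measurable]: "Y t \<in> borel_measurable M"
begin

lemma inverse_stable_obtain:
  obtains D where "stable_subordinator M \<alpha> D" "\<And>\<omega>. \<omega> \<in> space M \<Longrightarrow> Y t \<omega> = first_passage D t \<omega>"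
  using inv t unfolding inverse_stable_subordinator_def by auto

lemma inverse_stable_nonneg: "\<omega> \<in> space M \<Longrightarrow> 0 \<le> Y t \<omega>"
  using inverse_stable_obtain by (metis first_passage_def enn2real_nonneg)

text \<open>If Y(t) > n > 0, the level t has not been exceeded at time n, so D(n) \<le> t and the
  Chernoff bound applies.\<close>

lemma inverse_stable_tail:
  assumes "0 < s"
  shows "prob {\<omega> \<in> space M. real n < Y t \<omega>} \<le> exp (s * t) * exp (- real n * s powr \<alpha>)"
\<comment> \<open>The infimum ranges over x > 0 and says nothing about D(0); for n = 0 the bound is
  at least 1 anyway.\<close>
proof (cases "n = 0")
  case True
  have "prob {\<omega> \<in> space M. real n < Y t \<omega>} \<le> 1" by simp
  also have "1 \<le> exp (s * t)" using assms t by simp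
  finally show ?thesis using True by simp
next
  case False
  obtain D where D: "stable_subordinator M \<alpha> D" "\<And>\<omega>. \<omega> \<in> space M \<Longrightarrow> Y t \<omega> = first_passage D t \<omega>"
    using inverse_stable_obtain by blast
  have [measurable]: "D (real n) \<in> borel_measurable M"
    by (rule stable_subordinator_measurable[OF D(1)]) simp
  have "prob {\<omega> \<in> space M. real n < Y t \<omega>} \<le> prob {\<omega> \<in> space M. D (real n) \<omega> \<le> t}"
  proof (rule finite_measure_mono)
    show "{\<omega> \<in> space M. real n < Y t \<omega>} \<subseteq> {\<omega> \<in> space M. D (real n) \<omega> \<le> t}"
    proof safe
      fix \<omega> assume "\<omega> \<in> space M" "real n < Y t \<omega>"
      then show "D (real n) \<omega> \<le> t"
        using D(2)[of \<omega>] first_passage_le[of "real n" t D \<omega>] False by linarith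
    qed
  qed measurable
  also have "\<dots> \<le> exp (s * t) * exp (- real n * s powr \<alpha>)"
    by (rule stable_subordinator_lower_tail[OF D(1)]) (use assms in auto)
  finally show ?thesis .
qed

text \<open>The estimate behind finite order. With s = (2a)^(1/\<alpha>) the tail rate s^\<alpha> is
  2a, as the tail sum requires, at the cost of a factor exp(s t) whose exponent is of order
  a^(1/\<alpha>).\<close>

lemma inverse_stable_exp_moment:
  assumes "1 \<le> a"
  shows "integrable M (\<lambda>\<omega>. exp (a * Y t \<omega>))"
    and "expectation (\<lambda>\<omega>. exp (a * Y t \<omega>)) \<le> exp ((2 powr (1 / \<alpha>) * t + 3) * a ^ nat \<lceil>1 / \<alpha>\<rceil>)"
proof -
  define s where "s = (2 * a) powr (1 / \<alpha>)"
  define m where "m = nat \<lceil>1 / \<alpha>\<rceil>"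
  have "0 < s" using assms by (simp add: s_def)
  have "s powr \<alpha> = 2 * a" using alpha assms by (simp add: s_def powr_powr)
  then have tail: "prob {\<omega> \<in> space M. real n < Y t \<omega>} \<le> exp (s * t) * exp (- 2 * a * real n)" for n
    using inverse_stable_tail[OF \<open>0 < s\<close>, of n] by (simp add: mult.commute)
  show "integrable M (\<lambda>\<omega>. exp (a * Y t \<omega>))"
    by (rule exp_moment_le_tail_sum(1)[OF Y_meas assms _ tail]) simp
  have "expectation (\<lambda>\<omega>. exp (a * Y t \<omega>)) \<le> 1 + 2 * exp (s * t) * exp a"
    by (rule exp_moment_le_tail_sum(2)[OF Y_meas assms _ tail]) simp
  also have "\<dots> \<le> exp 2 * (exp (s * t) * exp a)"
  proof -
    have "1 * 1 \<le> exp (s * t) * exp a"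
      using assms t \<open>0 < s\<close> by (intro mult_mono) auto
    moreover have "3 \<le> exp (2::real)" using exp_ge_add_one_self[of 2] by simp
    then have "3 * (exp (s * t) * exp a) \<le> exp 2 * (exp (s * t) * exp a)"
      by (intro mult_right_mono) auto
    ultimately show ?thesis by linarith
  qed
  also have "\<dots> = exp (2 + s * t + a)" by (simp add: exp_add)
  also have "\<dots> \<le> exp ((2 powr (1 / \<alpha>) * t + 3) * a ^ m)"
  proof -
    have "1 / \<alpha> \<le> real m" by (simp add: m_def real_nat_ceiling_ge)
    moreover have "1 < 1 / \<alpha>" using alpha by simp
    \<comment> \<open>As \<alpha> < 1, the exponent m exceeds 1, so that the linear term a is
      absorbed by a^m.\<close>
    ultimately have m: "1 < m" by linarith
    have "a powr (1 / \<alpha>) \<le> a powr real m" using assms \<open>1 / \<alpha> \<le> real m\<close> by (intro powr_mono) auto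
    also have "\<dots> = a ^ m" using assms by (simp add: powr_realpow)
    finally have "s \<le> 2 powr (1 / \<alpha>) * a ^ m"
      using assms by (simp add: s_def powr_mult)
    then have "s * t \<le> 2 powr (1 / \<alpha>) * a ^ m * t" using t by (intro mult_right_mono) auto
    moreover have "a ^ 1 \<le> a ^ m" using assms m by (intro power_increasing) auto
    ultimately show ?thesis using assms by (simp add: algebra_simps)
  qed
  finally show "expectation (\<lambda>\<omega>. exp (a * Y t \<omega>)) \<le> exp ((2 powr (1 / \<alpha>) * t + 3) * a ^ nat \<lceil>1 / \<alpha>\<rceil>)"
    by (simp add: m_def)
qed

text \<open>Otherwise D(x) > t almost surely for every x > 0, so that exp(-x) = E exp(-D(x)) \<le>
  exp(-t), which fails for x = t/2.\<close>

lemma inverse_stable_not_0: "\<not> (AE \<omega> in M. Y t \<omega> = 0)"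
proof
  assume ae: "AE \<omega> in M. Y t \<omega> = 0"
  obtain D where D: "stable_subordinator M \<alpha> D" "\<And>\<omega>. \<omega> \<in> space M \<Longrightarrow> Y t \<omega> = first_passage D t \<omega>"
    using inverse_stable_obtain by blast
  have le: "exp (- x) \<le> exp (- t)" if "0 < x" for x
  proof -
    have [measurable]: "D x \<in> borel_measurable M"
      by (rule stable_subordinator_measurable[OF D(1)]) (use that in simp)
    \<comment> \<open>Exceedance of t at some time must be brought in, since
      \<open>first_passage\<close> is also 0 when the infimum is over the empty set.\<close>
    have "AE \<omega> in M. t < D x \<omega>"
      using ae stable_subordinator_exceeds[OF D(1), of t] AE_space
    proof eventually_elim
      case (elim \<omega>)
      then obtain x' where x': "0 < x'" "t < D x' \<omega>" by blast
      show ?case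
      proof (rule ccontr)
        assume "\<not> t < D x \<omega>"
        then have "x \<le> first_passage D t \<omega>"
          using D(1) elim that x' unfolding stable_subordinator_def
          by (intro le_first_passage[of D \<omega> x t x']) auto
        then show False using that elim D(2) by simp
      qed
    qed
    then have "expectation (\<lambda>\<omega>. exp (- 1 * D x \<omega>)) \<le> expectation (\<lambda>\<omega>. exp (- t))"
      by (intro integral_mono_AE stable_subordinator_integrable[OF D(1)]) (use that in auto)
    moreover have "expectation (\<lambda>\<omega>. exp (- 1 * D x \<omega>)) = exp (- x * 1 powr \<alpha>)"
      by (rule stable_subordinator_laplace[OF D(1)]) (use that in auto)
    ultimately show ?thesis by (simp add: prob_space)
  qed
  show False using le[of "t / 2"] t by simp
qed

text \<open>Otherwise D(\<epsilon>) \<le> t almost surely, and Laplace transforms give \<epsilon>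
  s^\<alpha> \<le> s t for all s > 0. For small s this fails because \<alpha> < 1.\<close>

lemma inverse_stable_small:
  assumes "0 < \<epsilon>"
  shows "0 < prob {\<omega> \<in> space M. Y t \<omega> \<le> \<epsilon>}"
proof (rule ccontr)
  assume "\<not> ?thesis"
  then have "prob {\<omega> \<in> space M. Y t \<omega> \<le> \<epsilon>} = 0" by (metis measure_nonneg order_le_less)
  then have ae: "AE \<omega> in M. \<not> Y t \<omega> \<le> \<epsilon>"
    by (subst AE_iff_measurable[where N = "{\<omega> \<in> space M. Y t \<omega> \<le> \<epsilon>}"]) (auto simp: emeasure_eq_measure)
  obtain D where D: "stable_subordinator M \<alpha> D" "\<And>\<omega>. \<omega> \<in> space M \<Longrightarrow> Y t \<omega> = first_passage D t \<omega>"
    using inverse_stable_obtain by blast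
  have [measurable]: "D \<epsilon> \<in> borel_measurable M"
    by (rule stable_subordinator_measurable[OF D(1)]) (use assms in simp)
  have ae: "AE \<omega> in M. D \<epsilon> \<omega> \<le> t"
    using ae AE_space
  proof eventually_elim
    case (elim \<omega>)
    then show ?case using first_passage_le[OF assms, of t D \<omega>] D(2)[of \<omega>] by linarith
  qed
  have le: "\<epsilon> * s powr \<alpha> \<le> s * t" if "0 < s" for s
  proof -
    have "AE \<omega> in M. exp (- s * t) \<le> exp (- s * D \<epsilon> \<omega>)"
      using ae by eventually_elim (use that in \<open>simp add: mult_left_mono\<close>)
    then have "expectation (\<lambda>\<omega>. exp (- s * t)) \<le> expectation (\<lambda>\<omega>. exp (- s * D \<epsilon> \<omega>))"
      by (intro integral_mono_AE stable_subordinator_integrable[OF D(1)]) (use that assms in auto)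
    also have "expectation (\<lambda>\<omega>. exp (- s * D \<epsilon> \<omega>)) = exp (- \<epsilon> * s powr \<alpha>)"
      by (rule stable_subordinator_laplace[OF D(1)]) (use that assms in auto)
    finally show ?thesis by (simp add: prob_space)
  qed
  \<comment> \<open>Solves s t = \<epsilon> s^\<alpha> / 2, which violates the inequality by a
    factor 2.\<close>
  define s where "s = (\<epsilon> / (2 * t)) powr (1 / (1 - \<alpha>))"
  have s: "0 < s" using assms t by (simp add: s_def)
  have "s powr (1 - \<alpha>) = \<epsilon> / (2 * t)"
    using alpha assms t by (simp add: s_def powr_powr)
  then have "s = s powr \<alpha> * (\<epsilon> / (2 * t))"
    using s by (metis add_diff_cancel_left' diff_add_cancel powr_add powr_one order_less_imp_le)
  then have "s * t = s powr \<alpha> * \<epsilon> / 2"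
    using t by (simp add: field_simps)
  moreover have "0 < s powr \<alpha> * \<epsilon>" using s assms by simp
  ultimately show False using le[OF s] by (simp add: mult.commute)
qed

end

end

section \<open>Time-changed counting processes\<close>

text \<open>The exponent \<psi> in the generating function exp(-t \<psi>(u)) of a generalized
  counting process, polymorphic so that the real function and its complex extension share one
  definition.\<close>

definition jump_exponent :: "nat \<Rightarrow> (nat \<Rightarrow> real) \<Rightarrow> 'a \<Rightarrow> 'a :: {real_normed_field}" where
  "jump_exponent k r u = (\<Sum>j = 1..k. of_real (r j) * (1 - u ^ j))"

lemma of_real_jump_exponent: "jump_exponent k r (of_real x) = of_real (jump_exponent k r x)"
  by (simp add: jump_exponent_def)

lemma holomorphic_jump_exponent: "jump_exponent k r holomorphic_on A"
  unfolding jump_exponent_def[abs_def] by (intro holomorphic_intros)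

lemma jump_exponent_nonneg:
  fixes u :: real
  assumes "\<And>j. j \<in> {1..k} \<Longrightarrow> 0 < r j" "0 \<le> u" "u \<le> 1"
  shows "0 \<le> jump_exponent k r u"
  unfolding jump_exponent_def using assms
  by (intro sum_nonneg mult_nonneg_nonneg) (auto simp: power_le_one intro: less_imp_le)

text \<open>Fundamental theorem of algebra: the coefficient of u^k is -r(k), which is nonzero, so
  subtracting c leaves a nonconstant polynomial.\<close>

lemma jump_exponent_surj:
  fixes c :: complex
  assumes "1 \<le> k" "r k \<noteq> 0"
  obtains u where "jump_exponent k r u = c"
proof -
  define p where "p = (\<Sum>j = 1..k. smult (of_real (r j)) (1 - monom 1 j)) - [:c:]"
  have p: "poly p u = jump_exponent k r u - c" for u
    by (simp add: p_def poly_sum poly_monom jump_exponent_def)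
  have "coeff p k = (\<Sum>j = 1..k. of_real (r j) * (- (if j = k then 1 else 0)))"
    using assms(1) by (simp add: p_def coeff_sum coeff_pCons coeff_1 split: nat.split)
  also have "\<dots> = - of_real (r k)"
    using assms(1) by (simp add: if_distrib sum.delta' cong: if_cong)
  finally have "degree p \<noteq> 0"
    using assms le_degree[of p k] by auto
  then obtain u where "poly p u = 0" using alg_closed_imp_poly_has_root by blast
  then show ?thesis using p that by simp
qed

section \<open>Paths and values of counting processes\<close>

lemma process_path_apply [simp]: "0 \<le> s \<Longrightarrow> process_path X \<omega> s = X s \<omega>"
  by (simp add: process_path_def)

lemma measurable_nat_path_space:
  "0 \<le> s \<Longrightarrow> (\<lambda>p. p s) \<in> measurable nat_path_space (count_space UNIV)"
  unfolding nat_path_space_def by (rule measurable_component_singleton) simp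

lemma measurable_real_path_space:
  "0 \<le> s \<Longrightarrow> (\<lambda>p. p s) \<in> measurable real_path_space borel"
  unfolding real_path_space_def by (rule measurable_component_singleton) simp

lemma gcp_rate_pos: "generalized_counting_process P k r M \<Longrightarrow> j \<in> {1..k} \<Longrightarrow> 0 < r j"
  unfolding generalized_counting_process_def by blast

lemma gcp_jump_exponent_surj:
  fixes c :: complex
  assumes "generalized_counting_process P k r M"
  obtains u where "jump_exponent k r u = c"
proof -
  have "1 \<le> k" using assms unfolding generalized_counting_process_def by blast
  with gcp_rate_pos[OF assms, of k] show ?thesis
    using jump_exponent_surj[of k r c] that by auto
qed

lemma gcp_jump_exponent_nonneg:
  "generalized_counting_process P k r M \<Longrightarrow> 0 \<le> (u :: real) \<Longrightarrow> u \<le> 1 \<Longrightarrow> 0 \<le> jump_exponent k r u"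
  by (intro jump_exponent_nonneg gcp_rate_pos)

text \<open>The values are integers, so convergence along times approaching s from the right is
  eventual equality.\<close>

lemma gcp_right_continuous:
  assumes "generalized_counting_process P k r M" "\<omega> \<in> space P" "0 \<le> s"
    and "filterlim q (at_right s) sequentially"
  shows "eventually (\<lambda>n. M (q n) \<omega> = M s \<omega>) sequentially"
proof (rule tendsto_real_eventually_eq)
  have "continuous (at_right s) (\<lambda>s. real (M s \<omega>))"
    using assms unfolding generalized_counting_process_def right_continuous_paths_def by auto
  then show "(\<lambda>n. real (M (q n) \<omega>)) \<longlonglongrightarrow> real (M s \<omega>)"
    unfolding continuous_within by (rule filterlim_compose) (fact assms(4))
qed

text \<open>For y \<ge> 0, \<open>grid_time n (grid_index n y)\<close> lies on the grid of mesh
  1/(n+1), strictly to the right of y. It takes countably many values, so a random time can be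
  handled by conditioning on the index.\<close>

definition grid_index :: "nat \<Rightarrow> real \<Rightarrow> nat" where
  "grid_index n y = nat \<lfloor>real (Suc n) * y\<rfloor>"

definition grid_time :: "nat \<Rightarrow> nat \<Rightarrow> real" where
  "grid_time n j = (real j + 1) / real (Suc n)"

lemma grid_time_nonneg: "0 \<le> grid_time n j"
  by (simp add: grid_time_def)

lemma grid_index_measurable [measurable]: "grid_index n \<in> measurable borel (count_space UNIV)"
  unfolding grid_index_def[abs_def] by measurable

context prob_space begin

lemma gcp_pgf:
  assumes "generalized_counting_process M k r N" "0 \<le> s" "0 \<le> u" "u \<le> 1"
  shows "expectation (\<lambda>\<omega>. u ^ N s \<omega>) = exp (- s * jump_exponent k r u)"
  using assms unfolding generalized_counting_process_def jump_exponent_def by auto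

lemma gcp_measurable:
  "generalized_counting_process M k r N \<Longrightarrow> 0 \<le> s \<Longrightarrow> N s \<in> measurable M (count_space UNIV)"
  unfolding generalized_counting_process_def by blast

text \<open>Conditioning on M0(s) = n leaves the mean exp(-\<psi>(u))^n, where \<psi> is the
  exponent of \<open>M1\<close>. What remains is the generating function of \<open>M0\<close> at
  exp(-\<psi>(u)), a point of [0,1] because \<psi>(u) \<ge> 0.\<close>

lemma igcp_pgf:
  assumes M0: "generalized_counting_process M k0 mu M0" and M1: "generalized_counting_process M k lam M1"
    and ind: "indep_elements M nat_path_space (process_path M0) nat_path_space (process_path M1)"
    and s: "0 \<le> s" and u: "0 \<le> u" "u \<le> 1"
  shows "expectation (\<lambda>\<omega>. u ^ M1 (real (M0 s \<omega>)) \<omega>)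
    = exp (- s * jump_exponent k0 mu (exp (- jump_exponent k lam u)))"
proof -
  have [measurable]: "M0 s \<in> measurable M (count_space UNIV)" "M1 (real n) \<in> measurable M (count_space UNIV)" for n
    using gcp_measurable[OF M0] gcp_measurable[OF M1] s by auto
  have "expectation (\<lambda>\<omega>. u ^ M1 (real (M0 s \<omega>)) \<omega>)
      = expectation (\<lambda>\<omega>. expectation (\<lambda>\<omega>'. u ^ M1 (real (M0 s \<omega>)) \<omega>'))"
  proof (rule expectation_random_index[where Z = "\<lambda>n \<omega>. u ^ M1 (real n) \<omega>"])
    fix n
    have "integrable M (\<lambda>\<omega>. indicator {n} (process_path M0 \<omega> s) :: real)"
      "integrable M (\<lambda>\<omega>. u ^ process_path M1 \<omega> (real n))"
      using s u by (auto intro!: integrable_const_bound[of _ 1] simp: indicator_def power_le_one)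
    moreover have "(\<lambda>p. indicator {n} (p s) :: real) \<in> borel_measurable nat_path_space"
      "(\<lambda>p. u ^ p (real n)) \<in> borel_measurable nat_path_space"
      using s by (auto intro!: measurable_compose[OF measurable_nat_path_space])
    ultimately have "expectation (\<lambda>\<omega>. indicator {n} (process_path M0 \<omega> s) * u ^ process_path M1 \<omega> (real n))
        = expectation (\<lambda>\<omega>. indicator {n} (process_path M0 \<omega> s)) * expectation (\<lambda>\<omega>. u ^ process_path M1 \<omega> (real n))"
      by (intro indep_elements_expectation_mult[OF ind])
    then show "expectation (\<lambda>\<omega>. indicator {n} (M0 s \<omega>) * u ^ M1 (real n) \<omega>)
      = expectation (\<lambda>\<omega>. indicator {n} (M0 s \<omega>)) * expectation (\<lambda>\<omega>. u ^ M1 (real n) \<omega>)"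
      using s by simp
    show "\<bar>u ^ M1 (real n) \<omega>\<bar> \<le> 1" for \<omega> using u by (simp add: power_le_one)
  qed measurable
  also have "\<dots> = expectation (\<lambda>\<omega>. exp (- jump_exponent k lam u) ^ M0 s \<omega>)"
    using u by (simp add: gcp_pgf[OF M1] exp_of_nat_mult[symmetric])
  also have "\<dots> = exp (- s * jump_exponent k0 mu (exp (- jump_exponent k lam u)))"
  proof (rule gcp_pgf[OF M0 s])
    have "0 \<le> jump_exponent k lam u"
      by (rule gcp_jump_exponent_nonneg[OF M1 u])
    then show "exp (- jump_exponent k lam u) \<le> 1" by simp
  qed simp
  finally show ?thesis .
qed

section \<open>The time-changed process at a fixed time\<close>

context
  fixes \<alpha> t :: real and k0 k :: nat and mu lam :: "nat \<Rightarrow> real"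
    and M0 M1 :: "real \<Rightarrow> 'a \<Rightarrow> nat" and Y :: "real \<Rightarrow> 'a \<Rightarrow> real"
  assumes alpha: "0 < \<alpha>" "\<alpha> < 1" and t: "0 < t"
    and M0: "generalized_counting_process M k0 mu M0" and M1: "generalized_counting_process M k lam M1"
    and ind: "indep_elements M nat_path_space (process_path M0) nat_path_space (process_path M1)"
    and inv: "inverse_stable_subordinator M \<alpha> Y"
    and indY: "indep_elements M real_path_space (process_path Y)
      (nat_path_space \<Otimes>\<^sub>M nat_path_space) (\<lambda>\<omega>. (process_path M1 \<omega>, process_path M0 \<omega>))"
begin

lemma Y_measurable [measurable]: "Y t \<in> borel_measurable M"
proof -
  have "(\<lambda>\<omega>. process_path Y \<omega> t) \<in> borel_measurable M"
    using measurable_compose[OF indep_elements_measurable[OF indY] measurable_real_path_space[of t]] t by simp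
  then show ?thesis using t by simp
qed

lemma igcp_measurable:
  assumes "0 \<le> s"
  shows "(\<lambda>\<omega>. M1 (real (M0 s \<omega>)) \<omega>) \<in> measurable M (count_space UNIV)"
  by (rule measurable_compose_countable[of "\<lambda>n \<omega>. M1 (real n) \<omega>"])
    (use gcp_measurable[OF M0] gcp_measurable[OF M1] assms in auto)

lemma grid_time_tendsto:
  "\<omega> \<in> space M \<Longrightarrow> filterlim (\<lambda>n. grid_time n (grid_index n (Y t \<omega>))) (at_right (Y t \<omega>)) sequentially"
  unfolding grid_time_def grid_index_def
  by (rule grid_tendsto_at_right) (rule inverse_stable_nonneg[OF alpha t inv Y_measurable])

text \<open>By right-continuity \<open>M0\<close> at the grid time eventually equals
  \<open>M0\<close> at Y(t), and then \<open>M1\<close> is evaluated at the very same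
  integer.\<close>

lemma grid_igcp_eventually:
  assumes "\<omega> \<in> space M"
  shows "eventually (\<lambda>n. M1 (real (M0 (grid_time n (grid_index n (Y t \<omega>))) \<omega>)) \<omega>
    = time_changed_IGCP M1 M0 Y t \<omega>) sequentially"
  using gcp_right_continuous[OF M0 assms _ grid_time_tendsto[OF assms]]
    inverse_stable_nonneg[OF alpha t inv Y_measurable assms]
  by (auto simp: time_changed_IGCP_def elim: eventually_mono)

lemma grid_igcp_measurable [measurable]:
  "(\<lambda>\<omega>. M1 (real (M0 (grid_time n (grid_index n (Y t \<omega>))) \<omega>)) \<omega>) \<in> measurable M (count_space UNIV)"
  by (rule measurable_compose_countable[of "\<lambda>j \<omega>. M1 (real (M0 (grid_time n j) \<omega>)) \<omega>"])
    (use igcp_measurable grid_time_nonneg in auto)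

text \<open>Measurability at each fixed time does not immediately give it at a random time; the grid
  approximations are measurable, having a countable index, and converge pointwise.\<close>

lemma time_changed_measurable [measurable]:
  "time_changed_IGCP M1 M0 Y t \<in> measurable M (count_space UNIV)"
proof -
  have "(\<lambda>\<omega>. real (time_changed_IGCP M1 M0 Y t \<omega>)) \<in> borel_measurable M"
  proof (rule borel_measurable_LIMSEQ_real)
    show "(\<lambda>n. real (M1 (real (M0 (grid_time n (grid_index n (Y t \<omega>))) \<omega>)) \<omega>))
        \<longlonglongrightarrow> real (time_changed_IGCP M1 M0 Y t \<omega>)" if "\<omega> \<in> space M" for \<omega>
      by (rule tendsto_eventually) (use grid_igcp_eventually[OF that] in \<open>auto elim: eventually_mono\<close>)
  qed measurable
  then have "(\<lambda>\<omega>. nat \<lfloor>real (time_changed_IGCP M1 M0 Y t \<omega>)\<rfloor>) \<in> measurable M (count_space UNIV)"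
    by measurable
  then show ?thesis by simp
qed

text \<open>Conditioning on the grid index, which depends on the path of \<open>Y\<close> alone and
  is therefore independent of the pair of counting processes; given the index, the time is
  fixed.\<close>

lemma grid_igcp_pgf:
  assumes u: "0 \<le> u" "u \<le> 1"
  shows "expectation (\<lambda>\<omega>. u ^ M1 (real (M0 (grid_time n (grid_index n (Y t \<omega>))) \<omega>)) \<omega>)
    = expectation (\<lambda>\<omega>. exp (- grid_time n (grid_index n (Y t \<omega>)) * jump_exponent k0 mu (exp (- jump_exponent k lam u))))"
proof -
  have "expectation (\<lambda>\<omega>. u ^ M1 (real (M0 (grid_time n (grid_index n (Y t \<omega>))) \<omega>)) \<omega>)
    = expectation (\<lambda>\<omega>. expectation (\<lambda>\<omega>'. u ^ M1 (real (M0 (grid_time n (grid_index n (Y t \<omega>))) \<omega>')) \<omega>'))"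
  proof (rule expectation_random_index[where Z = "\<lambda>j \<omega>. u ^ M1 (real (M0 (grid_time n j) \<omega>)) \<omega>"])
    fix j
    define s where "s = grid_time n j"
    have s: "0 \<le> s" by (simp add: s_def grid_time_nonneg)
    have [measurable]: "(\<lambda>\<omega>. M1 (real (M0 s \<omega>)) \<omega>) \<in> measurable M (count_space UNIV)"
      by (rule igcp_measurable) (rule s)
    then have meas: "(\<lambda>\<omega>. u ^ M1 (real (M0 s \<omega>)) \<omega>) \<in> borel_measurable M"
      by measurable
    then show "(\<lambda>\<omega>. u ^ M1 (real (M0 (grid_time n j) \<omega>)) \<omega>) \<in> borel_measurable M"
      unfolding s_def .
    \<comment> \<open>\<open>f\<close> and \<open>g\<close> express the index event and the power of
      \<open>u\<close> as measurable functionals of paths, the form in which independence is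
      given.\<close>
    define f where "f p = (indicator {j} (nat \<lfloor>real (Suc n) * p t\<rfloor>) :: real)" for p :: "real \<Rightarrow> real"
    define g where "g x = u ^ (fst x (real (snd x s)))" for x :: "(real \<Rightarrow> nat) \<times> (real \<Rightarrow> nat)"
    have [measurable]: "(\<lambda>p. p t) \<in> measurable real_path_space borel"
      using t by (intro measurable_real_path_space) simp
    have f: "f \<in> borel_measurable real_path_space"
      unfolding f_def[abs_def] by measurable
    \<comment> \<open>One path is evaluated at a time read off the other. This is measurable because
      that time is an integer, so that countably many cases arise.\<close>
    have "(\<lambda>x. fst x (real (snd x s))) \<in> measurable (nat_path_space \<Otimes>\<^sub>M nat_path_space) (count_space UNIV)"
    proof (rule measurable_compose_countable[of "\<lambda>m x. fst x (real m)"])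
      show "(\<lambda>x. fst x (real m)) \<in> measurable (nat_path_space \<Otimes>\<^sub>M nat_path_space) (count_space UNIV)" for m
        by (rule measurable_compose[OF measurable_fst measurable_nat_path_space]) simp
      show "(\<lambda>x. snd x s) \<in> measurable (nat_path_space \<Otimes>\<^sub>M nat_path_space) (count_space UNIV)"
        by (rule measurable_compose[OF measurable_snd measurable_nat_path_space]) (rule s)
    qed
    then have g: "g \<in> borel_measurable (nat_path_space \<Otimes>\<^sub>M nat_path_space)"
      unfolding g_def[abs_def] by (rule measurable_compose) simp
    have fX: "f (process_path Y \<omega>) = indicator {j} (grid_index n (Y t \<omega>))" for \<omega>
      using t by (simp add: f_def grid_index_def)
    have gX: "g (process_path M1 \<omega>, process_path M0 \<omega>) = u ^ M1 (real (M0 s \<omega>)) \<omega>" for \<omega>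
      using s by (simp add: g_def)
    have "integrable M (\<lambda>\<omega>. f (process_path Y \<omega>))" "integrable M (\<lambda>\<omega>. g (process_path M1 \<omega>, process_path M0 \<omega>))"
      unfolding fX gX using u meas by (auto intro!: integrable_const_bound[of _ 1] simp: indicator_def power_le_one)
    from indep_elements_expectation_mult[where f = f and g = g, OF indY f g this]
    show "expectation (\<lambda>\<omega>. indicator {j} (grid_index n (Y t \<omega>)) * u ^ M1 (real (M0 (grid_time n j) \<omega>)) \<omega>)
      = expectation (\<lambda>\<omega>. indicator {j} (grid_index n (Y t \<omega>))) * expectation (\<lambda>\<omega>. u ^ M1 (real (M0 (grid_time n j) \<omega>)) \<omega>)"
      unfolding fX gX s_def .
    show "\<bar>u ^ M1 (real (M0 (grid_time n j) \<omega>)) \<omega>\<bar> \<le> 1" for \<omega> using u by (simp add: power_le_one)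
  qed measurable
  then show ?thesis
    by (simp only: igcp_pgf[OF M0 M1 ind grid_time_nonneg u])
qed

text \<open>The grid identity passes to the limit by dominated convergence with bound 1.\<close>

lemma time_changed_pgf:
  assumes u: "0 \<le> u" "u \<le> 1"
  shows "expectation (\<lambda>\<omega>. u ^ time_changed_IGCP M1 M0 Y t \<omega>)
    = expectation (\<lambda>\<omega>. exp (- jump_exponent k0 mu (exp (- jump_exponent k lam u)) * Y t \<omega>))"
proof (rule LIMSEQ_unique)
  define \<psi> where "\<psi> = jump_exponent k0 mu (exp (- jump_exponent k lam u))"
  have "0 \<le> jump_exponent k lam u"
    by (rule gcp_jump_exponent_nonneg[OF M1 u])
  then have \<psi>: "0 \<le> \<psi>"
    unfolding \<psi>_def by (intro gcp_jump_exponent_nonneg[OF M0]) auto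
  show "(\<lambda>n. expectation (\<lambda>\<omega>. u ^ M1 (real (M0 (grid_time n (grid_index n (Y t \<omega>))) \<omega>)) \<omega>))
      \<longlonglongrightarrow> expectation (\<lambda>\<omega>. u ^ time_changed_IGCP M1 M0 Y t \<omega>)"
  proof (rule integral_dominated_convergence[where w = "\<lambda>_. 1"])
    show "AE \<omega> in M. (\<lambda>n. u ^ M1 (real (M0 (grid_time n (grid_index n (Y t \<omega>))) \<omega>)) \<omega>)
        \<longlonglongrightarrow> u ^ time_changed_IGCP M1 M0 Y t \<omega>"
    proof (rule AE_I2, rule tendsto_eventually)
      fix \<omega> assume "\<omega> \<in> space M"
      from grid_igcp_eventually[OF this]
      show "eventually (\<lambda>n. u ^ M1 (real (M0 (grid_time n (grid_index n (Y t \<omega>))) \<omega>)) \<omega>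
          = u ^ time_changed_IGCP M1 M0 Y t \<omega>) sequentially"
        by eventually_elim simp
    qed
  qed (use u in \<open>auto simp: power_le_one\<close>)
  show "(\<lambda>n. expectation (\<lambda>\<omega>. u ^ M1 (real (M0 (grid_time n (grid_index n (Y t \<omega>))) \<omega>)) \<omega>))
      \<longlonglongrightarrow> expectation (\<lambda>\<omega>. exp (- jump_exponent k0 mu (exp (- jump_exponent k lam u)) * Y t \<omega>))"
    unfolding grid_igcp_pgf[OF u] \<psi>_def[symmetric]
  proof (rule integral_dominated_convergence[where w = "\<lambda>_. 1"])
    show "AE \<omega> in M. (\<lambda>n. exp (- grid_time n (grid_index n (Y t \<omega>)) * \<psi>)) \<longlonglongrightarrow> exp (- \<psi> * Y t \<omega>)"
    proof (rule AE_I2)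
      fix \<omega> assume "\<omega> \<in> space M"
      then have "(\<lambda>n. grid_time n (grid_index n (Y t \<omega>))) \<longlonglongrightarrow> Y t \<omega>"
        using grid_time_tendsto[of \<omega>] by (simp add: filterlim_at)
      then have "(\<lambda>n. exp (- grid_time n (grid_index n (Y t \<omega>)) * \<psi>)) \<longlonglongrightarrow> exp (- Y t \<omega> * \<psi>)"
        by (intro tendsto_intros)
      then show "(\<lambda>n. exp (- grid_time n (grid_index n (Y t \<omega>)) * \<psi>)) \<longlonglongrightarrow> exp (- \<psi> * Y t \<omega>)"
        by (simp add: mult.commute)
    qed
    show "AE \<omega> in M. norm (exp (- grid_time n (grid_index n (Y t \<omega>)) * \<psi>)) \<le> 1" for n
      using \<psi> grid_time_nonneg by (auto simp: mult_nonneg_nonneg)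
  qed measurable
qed

text \<open>The earlier estimate covers exponents a \<ge> 1, so x is compared with 1 + |x|; since
  Y(t) is nonnegative, this works for x < 0 as well.\<close>

lemma Y_exp_moment:
  shows "integrable M (\<lambda>\<omega>. exp (x * Y t \<omega>))"
    and "0 \<le> x \<Longrightarrow> expectation (\<lambda>\<omega>. exp (x * Y t \<omega>)) \<le> exp ((2 powr (1 / \<alpha>) * t + 3) * (1 + x) ^ nat \<lceil>1 / \<alpha>\<rceil>)"
proof -
  note * = inverse_stable_exp_moment[OF alpha t inv Y_measurable]
  note nonneg = inverse_stable_nonneg[OF alpha t inv Y_measurable]
  show int: "integrable M (\<lambda>\<omega>. exp (x * Y t \<omega>))" for x
  proof (rule Bochner_Integration.integrable_bound[OF *(1)[of "1 + \<bar>x\<bar>"]])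
    show "AE \<omega> in M. norm (exp (x * Y t \<omega>)) \<le> norm (exp ((1 + \<bar>x\<bar>) * Y t \<omega>))"
      using nonneg by (intro AE_I2) (auto intro!: mult_right_mono)
  qed auto
  assume "0 \<le> x"
  then have "expectation (\<lambda>\<omega>. exp (x * Y t \<omega>)) \<le> expectation (\<lambda>\<omega>. exp ((1 + x) * Y t \<omega>))"
    using nonneg by (intro integral_mono int) (auto intro!: mult_right_mono)
  also have "\<dots> \<le> exp ((2 powr (1 / \<alpha>) * t + 3) * (1 + x) ^ nat \<lceil>1 / \<alpha>\<rceil>)"
    using *(2)[of "1 + x"] \<open>0 \<le> x\<close> by simp
  finally show "expectation (\<lambda>\<omega>. exp (x * Y t \<omega>)) \<le> exp ((2 powr (1 / \<alpha>) * t + 3) * (1 + x) ^ nat \<lceil>1 / \<alpha>\<rceil>)" .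
qed

text \<open>Analytic continuation of the generating function from (0,1): \<open>g\<close> is entire,
  so the series with coefficients p(n) represents it everywhere. Convergence at exp x gives the
  exponential moments, and the value at exp z gives the transform.\<close>

lemma time_changed_exp_moment:
  defines "F \<equiv> \<lambda>z. LINT \<omega>|M. exp (z * complex_of_real (Y t \<omega>))"
  shows "integrable M (\<lambda>\<omega>. exp (x * real (time_changed_IGCP M1 M0 Y t \<omega>)))"
    and "(LINT \<omega>|M. exp (z * complex_of_real (real (time_changed_IGCP M1 M0 Y t \<omega>))))
      = F (- jump_exponent k0 mu (exp (- jump_exponent k lam (exp z))))"
proof -
  define g where "g z = F (- jump_exponent k0 mu (exp (- jump_exponent k lam z)))" for z
  define p where "p n = prob {\<omega> \<in> space M. time_changed_IGCP M1 M0 Y t \<omega> = n}" for n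
  have hol_F: "F holomorphic_on UNIV"
    unfolding F_def by (rule holomorphic_exp_moments[OF Y_measurable Y_exp_moment(1)])
  have "(F \<circ> (\<lambda>z. - jump_exponent k0 mu (exp (- jump_exponent k lam z)))) holomorphic_on UNIV"
    by (intro holomorphic_on_compose_gen[OF _ hol_F] holomorphic_intros
        holomorphic_on_compose_gen[OF _ holomorphic_jump_exponent, unfolded o_def]
        holomorphic_jump_exponent) auto
  then have hol_g: "g holomorphic_on UNIV" by (simp add: g_def[abs_def] o_def)
  have "summable p"
    unfolding p_def by (rule summable_prob_nat) measurable
  have pgf: "(\<lambda>n. complex_of_real (p n) * z ^ n) sums g z" for z
  proof (rule pgf_sums_entire[OF _ \<open>summable p\<close> hol_g])
    fix x :: real assume x: "0 < x" "x < 1"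
    have "summable (\<lambda>n. p n * norm (x ^ n))"
      by (rule summable_comparison_test'[OF \<open>summable p\<close>, of 0])
        (use x in \<open>auto simp: p_def power_le_one intro: mult_left_le\<close>)
    then have "(\<lambda>n. p n *\<^sub>R x ^ n) sums expectation (\<lambda>\<omega>. x ^ time_changed_IGCP M1 M0 Y t \<omega>)"
      unfolding p_def by (intro expectation_nat_sums(2)) measurable
    then have "(\<lambda>n. complex_of_real (p n * x ^ n))
        sums of_real (expectation (\<lambda>\<omega>. x ^ time_changed_IGCP M1 M0 Y t \<omega>))"
      unfolding sums_of_real_iff by simp
    also have "of_real (expectation (\<lambda>\<omega>. x ^ time_changed_IGCP M1 M0 Y t \<omega>)) = g (of_real x)"
      using x by (simp add: time_changed_pgf g_def F_def of_real_jump_exponent exp_of_real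
          flip: of_real_minus of_real_mult)
    finally show "(\<lambda>n. complex_of_real (p n * x ^ n)) sums g (of_real x)" .
  qed (simp add: p_def)
  have smb: "summable (\<lambda>n. p n * r ^ n)" for r :: real
    using pgf[of "of_real r"] by (simp add: sums_iff summable_of_real_iff flip: of_real_power of_real_mult)
  have "integrable M (\<lambda>\<omega>. exp x ^ time_changed_IGCP M1 M0 Y t \<omega>)"
    by (rule expectation_nat_sums(1)) (use smb[of "exp x"] in \<open>auto simp: p_def norm_power\<close>)
  then show "integrable M (\<lambda>\<omega>. exp (x * real (time_changed_IGCP M1 M0 Y t \<omega>)))"
    by (simp add: exp_of_nat2_mult)
  have "(\<lambda>n. p n *\<^sub>R exp z ^ n) sums expectation (\<lambda>\<omega>. exp z ^ time_changed_IGCP M1 M0 Y t \<omega>)"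
    unfolding p_def
    by (rule expectation_nat_sums(2)) (use smb[of "norm (exp z)"] in \<open>auto simp: p_def norm_power\<close>)
  with pgf[of "exp z"] have "expectation (\<lambda>\<omega>. exp z ^ time_changed_IGCP M1 M0 Y t \<omega>) = g (exp z)"
    by (simp add: scaleR_conv_of_real sums_unique2)
  then show "(LINT \<omega>|M. exp (z * complex_of_real (real (time_changed_IGCP M1 M0 Y t \<omega>))))
      = F (- jump_exponent k0 mu (exp (- jump_exponent k lam (exp z))))"
    by (simp add: g_def exp_of_nat2_mult)
qed

lemma time_changed_not_infinitely_divisible:
  "\<not> infinitely_divisible (distr M borel (\<lambda>\<omega>. real (time_changed_IGCP M1 M0 Y t \<omega>)))"
proof
  assume id: "infinitely_divisible (distr M borel (\<lambda>\<omega>. real (time_changed_IGCP M1 M0 Y t \<omega>)))"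
  have nz: "(LINT \<omega>|M. exp (z * complex_of_real (real (time_changed_IGCP M1 M0 Y t \<omega>)))) \<noteq> 0" for z
    using infinitely_divisible_imp_zero_free[OF id, of z] time_changed_exp_moment(1)
    by (simp add: integral_distr integrable_distr_eq)
  have "\<exists>a. Im a \<noteq> 0 \<and> (LINT \<omega>|M. exp (a * complex_of_real (Y t \<omega>))) = 0"
    by (rule exp_moment_has_zero[OF prob_space_axioms Y_measurable
          inverse_stable_nonneg[OF alpha t inv Y_measurable] Y_exp_moment(1) _ Y_exp_moment(2)
          inverse_stable_not_0[OF alpha t inv Y_measurable]
          inverse_stable_small[OF alpha t inv Y_measurable]])
      (use t in \<open>auto intro: add_nonneg_pos\<close>)
  then obtain a where a: "Im a \<noteq> 0" "(LINT \<omega>|M. exp (a * complex_of_real (Y t \<omega>))) = 0" by blast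
  obtain w where w: "jump_exponent k0 mu w = - a"
    using gcp_jump_exponent_surj[OF M0] by blast
  \<comment> \<open>\<open>jump_exponent k0 mu\<close> has real coefficients, so a real w would make
    a real. In particular w is not 0 and has a logarithm.\<close>
  have not_real: "w \<noteq> of_real x" for x
    using w a(1) of_real_jump_exponent[of k0 mu x, where 'a = complex]
    by (metis Im_complex_of_real add.inverse_inverse neg_equal_0_iff_equal uminus_complex.sel(2))
  then have "w \<noteq> 0" by (metis of_real_0)
  obtain u where u: "jump_exponent k lam u = - Ln w"
    using gcp_jump_exponent_surj[OF M1] by blast
  have eu: "exp (- jump_exponent k lam u) = w" using u \<open>w \<noteq> 0\<close> by simp
  \<comment> \<open>The point u must be of the form exp z; u = 0 would make w real.\<close>
  have "u \<noteq> 0"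
  proof
    assume "u = 0"
    then have "w = of_real (exp (- jump_exponent k lam 0))"
      using eu of_real_jump_exponent[of k lam 0, where 'a = complex] by (simp add: exp_of_real flip: of_real_minus)
    with not_real show False by blast
  qed
  then show False
    using nz[of "Ln u"] time_changed_exp_moment(2)[of "Ln u"] a(2) eu w by simp
qed

end
end

theorem proposition5p3:
  fixes P :: "'a measure"
    and \<alpha> :: real
    and k0 k :: nat
    and mu lam :: "nat \<Rightarrow> real"
    and M0 M :: "real \<Rightarrow> 'a \<Rightarrow> nat"
    and Y :: "real \<Rightarrow> 'a \<Rightarrow> real"
  assumes "prob_space P"
    and "0 < \<alpha>" and "\<alpha> < 1"
    and "generalized_counting_process P k0 mu M0"
    and "generalized_counting_process P k lam M"
    and "indep_elements P nat_path_space (process_path M0) nat_path_space (process_path M)"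
    and "inverse_stable_subordinator P \<alpha> Y"
    and "indep_elements P real_path_space (process_path Y)
           (nat_path_space \<Otimes>\<^sub>M nat_path_space) (\<lambda>\<omega>. (process_path M \<omega>, process_path M0 \<omega>))"
  shows "\<forall>t>0. \<not> infinitely_divisible (distr P borel (\<lambda>\<omega>. real (time_changed_IGCP M M0 Y t \<omega>)))"
proof (intro allI impI)
  fix t :: real assume "0 < t"
  interpret prob_space P by fact
  show "\<not> infinitely_divisible (distr P borel (\<lambda>\<omega>. real (time_changed_IGCP M M0 Y t \<omega>)))"
    by (rule time_changed_not_infinitely_divisible) fact+
qed

end
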